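(* For the set of stable equilibrium states of a system $A$ which correspond to a fixed set of values of the parameters $\boldsymbol{\beta}^A$, the temperature of $A$ is a strictly increasing function of the energy of $A$.
   Context: Basic notions. A system is a set of material particles of one or more kinds, those of each kind being contained at each instant in a given region of space; $\mathbf{R}^A$ denotes the set of regions of space occupied by the constituents of $A$. $A$ is closed if these regions are bounded by walls (surfaces that particles cannot cross). A property is defined by a reproducible measurement procedure; a state is the set of values of all properties at one instant. $AB$ denotes the composite (union) of $A$ and $B$. A system is isolated if no other particles are present in, or touch, the region it spans during its evolution and the external force field there (the field remaining when the system's particles are removed) is zero or stationary. If an isolated system is divided into subsystems $A,B$, then $B$ is the environment of $A$ and conversely. $A,B$ are separable if the force field produced by each vanishes in the region occupied by the other; they are uncorrelated if outcomes of measurements on each are statistically independent of those on the other. A process of $A$ from $A_1$ to $A_2$ is a time evolution of the isolated system $AB$ ($B$ the environment of $A$) taking $A$ from $A_1$ to $A_2$; it is reversible if $AB$ can evolve back to its initial state, otherwise irreversible. An elementary mechanical system is one whose only admissible change of state is a translation in a uniform external force field (e.g. a weight). A weight process $A_1\xrightarrow{\rm w}A_2$ is a process between states in which $A$ is separable from its environment, whose only net effect in the environment is the change of state of an elementary mechanical system. An equilibrium state is one in which the system is separable, which is constant in time, and which can be reproduced while the system is isolated. A stable equilibrium state (SES) of a closed system $A$ is an equilibrium state in which $A$ is uncorrelated from its environment $B$ and which cannot be modified by any process between states in which $A$ is separable and uncorrelated from its environment and such that neither the geometrical configuration of the walls bounding $\mathbf{R}^A$ nor the state of $B$ has a net change.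 $A$ and $B$ are in mutual stable equilibrium if $AB$ is in a SES. Energy. A weight polygonal for a closed system $A$ from $A_1$ to $A_n$ is a sequence of states $A_1,\dots,A_n$, in each of which $A$ is separable from its environment, consecutive ones being joined by a weight process in either direction; the work done in it is the sum of the works done by $A$ in the forward-directed processes minus those done in the backward-directed ones. Assumption 1: any two states of a closed system in which it is separable from its environment are joined by a weight polygonal. Postulate 1: the work done in a weight polygonal depends only on its end states. $E^A_2-E^A_1$ is minus the work done by $A$ in any weight polygonal from $A_1$ to $A_2$; energy is a property (up to a reference value) and energy differences are additive over separable subsystems. Postulate 2: among the states of a system $A$ with given $\mathbf{R}^A$ there is a SES for every value of the energy. Assumption 2: from any state in which it is separable from its environment, a closed system $A$ can be changed to a SES with the same energy by a zero-work weight process with no net change of $\mathbf{R}^A$. Postulate 3: there exist normal systems, whose energy has no upper bound; from any state in which it is separable from its environment, a normal system $A$ can be changed to a non-equilibrium state of arbitrarily higher energy (with $A$ separable from its environment) by a weight process for $A$ with no net change of $\mathbf{R}^A$. Postulate 4: any system $A$, in any SES $A_{\rm se1}$, is in mutual stable equilibrium with an identical copy $A^{\rm d}$ of $A$ in the same state. Standing restriction: all systems considered are normal, closed and (for parameters) nonreactive, so with fixed composition. Standard processes. Given states $A_1,A_2$ of $A$ in which $A$ is separable from its environment, and $B$ in the environment of $A$, a weight process for $AB$, standard with respect to $B$, is a weight process $A_1B_{\rm se1}\xrightarrow{\rm w}A_2B_{\rm se2}$ for $AB$ in which $B_{\rm se1},B_{\rm se2}$ are SESs with identical $\mathbf{R}^B$.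 Assumption 3: for any states $A_1,A_2$ in which $A$ is separable and uncorrelated from its environment, one can find or include in the environment a system $B$ with a SES $B_{\rm se1}$ such that $A_1$ and $A_2$ can be interconnected by a reversible weight process for $AB$, standard with respect to $B$, in which $B$ starts from $B_{\rm se1}$. Functions $f$. For SESs $B_{\rm se1},C_{\rm se1}$, consider pairs of reversible weight processes for $XB$ and $XC$, standard with respect to $B$ and $C$, starting from $(X_1,B_{\rm se1})$ and $(X_1,C_{\rm se1})$, with the same initial and final states of $X$, where $X$ is a system in the environment of $BC$ with initial state $X_1$ such that all SESs of $B$ (resp. $C$) with the same regions as $B_{\rm se1}$ (resp. $C_{\rm se1}$) are interconnected with it by such reversible processes. The final energies of $B$ and $C$ define a single-valued invertible function $E^C=f^{B\to C}_{11}(E^B)$ independent of $X$ and $X_1$. Assumption 4: $f^{B\to C}_{11}$ is differentiable at $E^B_{\rm se1}$. Temperature. Fix a reference system $R$, a SES $R_{\rm se1}$ of $R$ and a number $T^R_{\rm se1}>0$. The temperature of a SES $B_{\rm se1}$ is defined by $T^B_{\rm se1}/T^R_{\rm se1}=\frac{{\rm d}f^{R\to B}_{11}}{{\rm d}E^R}\big|_{E^R_{\rm se1}}$. It is a non-negative function $T^B(E^B;\mathbf{R}^B)$ of energy and regions of space. Assumption 5: for every $B$ and $\mathbf{R}^B$, the temperature is a continuous function of the energy and vanishes only in the SES of lowest energy. Entropy. For states $A_1,A_2$ of $A$ in which $A$ is separable and uncorrelated from its environment, $S^A_2-S^A_1=-\int_{E^B_{\rm se1}}^{E^B_{\rm se2}}\frac{{\rm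 d}E^B}{T^B(E^B;\mathbf{R}^B)}$, where $B_{\rm se1},B_{\rm se2}$ are the initial and final states of $B$ in any reversible weight process for $AB$ from $A_1$ to $A_2$, standard with respect to $B$, with $B$ any other system in the environment of $A$ and $B_{\rm se1}$ chosen so that the temperatures of $B_{\rm se1}$ and $B_{\rm se2}$ are non-vanishing; the value depends only on $A_1,A_2$. Parameters. A set of equivalent stable equilibrium states of a closed nonreactive system $A$ is a subset of its SESs such that any two of its members differ by some geometrical features of $\mathbf{R}^A$ and can be interconnected by a zero-work reversible weight process for $A$ (so they have the same energy and entropy). The parameters $\boldsymbol{\beta}^A=\beta^A_1,\dots,\beta^A_s$ ($s$ finite) are a minimal set of real variables sufficient to fully and uniquely parametrize all the different sets of equivalent SESs of $A$. The temperature of SESs is written $T^A(E^A,\boldsymbol{\beta}^A)=T^A(E^A;\mathbf{R}^A)$ for any $\mathbf{R}^A$ corresponding to $\boldsymbol{\beta}^A$. *)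

theory Defs
  imports "HOL-Analysis.Analysis"
begin

section \<open>Systems, states and processes\<close>

text \<open>
  A system is identified with the set of its particles and every state (of type \<open>'s\<close>) is a state
  of one definite system, its \<open>constituents\<close>. The state \<open>a \<bowtie> b\<close> is the state of the composite of
  two systems without common particles in which the first is in state \<open>a\<close>, the second is in state
  \<open>b\<close>, and the two are separable and uncorrelated. Not every state of a composite is of this form:
  states with interaction or correlation between the parts are just not of the form \<open>a \<bowtie> b\<close>.

  \<open>regions a\<close> stands for the regions of space occupied by the constituents, regardless of where the
  system as a whole is placed relative to other systems. \<open>evolves s t\<close> says that the system, being
  isolated, can evolve in time from \<open>s\<close> to \<open>t\<close>. The elements of \<open>weights\<close> are the elementary
  mechanical systems, and \<open>potential m\<close> is the potential energy of such a system in its external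
  force field. The elements of \<open>systems\<close> are the closed, normal and nonreactive systems.
\<close>

record ('p, 's, 'r) world =
  constituents :: "'s \<Rightarrow> 'p set"
  compose :: "'s \<Rightarrow> 's \<Rightarrow> 's"  (infixl "\<bowtie>\<index>" 70)
  regions :: "'s \<Rightarrow> 'r"
  evolves :: "'s \<Rightarrow> 's \<Rightarrow> bool"
  weights :: "'p set set"
  potential :: "'s \<Rightarrow> real"
  systems :: "'p set set"

definition apart :: "('p, 's, 'r, 'z) world_scheme \<Rightarrow> 's \<Rightarrow> 's \<Rightarrow> bool" where
  "apart W a b \<longleftrightarrow> constituents W a \<inter> constituents W b = {}"

definition same_regions :: "('p, 's, 'r, 'z) world_scheme \<Rightarrow> 's \<Rightarrow> 's \<Rightarrow> bool" where
  "same_regions W a b \<longleftrightarrow> constituents W a = constituents W b \<and> regions W a = regions W b"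

text \<open>
  In a weight process for a system from \<open>a\<close> to \<open>b\<close> the environment consists of an elementary
  mechanical system, which goes from \<open>m\<close> to \<open>m'\<close>, and of the rest, whose initial and final states
  coincide. The change of the elementary mechanical system being the only net effect outside the
  system, no correlations with the environment are used up or left behind. The work done by the
  system is the gain in potential energy of the elementary mechanical system.
\<close>

definition weight_setting ::
    "('p, 's, 'r, 'z) world_scheme \<Rightarrow> 's \<Rightarrow> 's \<Rightarrow> 's \<Rightarrow> 's \<Rightarrow> 's \<Rightarrow> real \<Rightarrow> bool" where
  "weight_setting W a b n m m' w \<longleftrightarrow>
     constituents W a = constituents W b \<and> constituents W m = constituents W m' \<and>
     constituents W m \<in> weights W \<and>
     apart W a n \<and> apart W a m \<and> apart W n m \<and>
     w = potential W m' - potential W m"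

definition weight_process :: "('p, 's, 'r, 'z) world_scheme \<Rightarrow> 's \<Rightarrow> 's \<Rightarrow> real \<Rightarrow> bool" where
  "weight_process W a b w \<longleftrightarrow> (\<exists>n m m'. weight_setting W a b n m m' w \<and>
     evolves W (a \<bowtie>\<^bsub>W\<^esub> (n \<bowtie>\<^bsub>W\<^esub> m)) (b \<bowtie>\<^bsub>W\<^esub> (n \<bowtie>\<^bsub>W\<^esub> m')))"

definition reversible_weight_process ::
    "('p, 's, 'r, 'z) world_scheme \<Rightarrow> 's \<Rightarrow> 's \<Rightarrow> real \<Rightarrow> bool" where
  "reversible_weight_process W a b w \<longleftrightarrow> (\<exists>n m m'. weight_setting W a b n m m' w \<and>
     evolves W (a \<bowtie>\<^bsub>W\<^esub> (n \<bowtie>\<^bsub>W\<^esub> m)) (b \<bowtie>\<^bsub>W\<^esub> (n \<bowtie>\<^bsub>W\<^esub> m')) \<and>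
     evolves W (b \<bowtie>\<^bsub>W\<^esub> (n \<bowtie>\<^bsub>W\<^esub> m')) (a \<bowtie>\<^bsub>W\<^esub> (n \<bowtie>\<^bsub>W\<^esub> m)))"

inductive weight_polygonal :: "('p, 's, 'r, 'z) world_scheme \<Rightarrow> 's \<Rightarrow> 's \<Rightarrow> real \<Rightarrow> bool"
  for W where
  start: "weight_polygonal W a a 0"
| forward: "weight_polygonal W a b v \<Longrightarrow> weight_process W b c w \<Longrightarrow> weight_polygonal W a c (v + w)"
| backward: "weight_polygonal W a b v \<Longrightarrow> weight_process W c b w \<Longrightarrow> weight_polygonal W a c (v - w)"


section \<open>Equilibrium\<close>

definition equilibrium :: "('p, 's, 'r, 'z) world_scheme \<Rightarrow> 's \<Rightarrow> bool" where
  "equilibrium W a \<longleftrightarrow> evolves W a a \<and> (\<forall>b. evolves W a b \<longrightarrow> b = a)"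

text \<open>Here \<open>n\<close> is the state of the environment, which has no net change.\<close>

definition SES :: "('p, 's, 'r, 'z) world_scheme \<Rightarrow> 's \<Rightarrow> bool" where
  "SES W a \<longleftrightarrow> constituents W a \<in> systems W \<and> equilibrium W a \<and>
     (\<forall>b n. apart W a n \<and> same_regions W a b \<and> evolves W (a \<bowtie>\<^bsub>W\<^esub> n) (b \<bowtie>\<^bsub>W\<^esub> n) \<longrightarrow> b = a)"

definition mutual_SES :: "('p, 's, 'r, 'z) world_scheme \<Rightarrow> 's \<Rightarrow> 's \<Rightarrow> bool" where
  "mutual_SES W a b \<longleftrightarrow> SES W (a \<bowtie>\<^bsub>W\<^esub> b)"

definition lowest_SES :: "('p, 's, 'r, 'z) world_scheme \<Rightarrow> ('s \<Rightarrow> real) \<Rightarrow> 's \<Rightarrow> bool" where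
  "lowest_SES W E a \<longleftrightarrow> SES W a \<and> (\<forall>b. SES W b \<and> same_regions W a b \<longrightarrow> E a \<le> E b)"

text \<open>
  A relabelling of particles \<open>p\<close> with induced map of states \<open>\<sigma>\<close> is a symmetry if it preserves all
  primitive notions. \<open>A'\<close> is an identical copy of \<open>A\<close> if exchanging the two, particle by particle,
  is a symmetry; then \<open>\<sigma> a\<close> is the state of the copy that is ``the same'' as the state \<open>a\<close> of \<open>A\<close>.
\<close>

definition symmetry ::
    "('p, 's, 'r, 'z) world_scheme \<Rightarrow> ('p \<Rightarrow> 'p) \<Rightarrow> ('s \<Rightarrow> 's) \<Rightarrow> bool" where
  "symmetry W p \<sigma> \<longleftrightarrow> bij p \<and> bij \<sigma> \<and>
     (\<forall>s. constituents W (\<sigma> s) = p ` constituents W s) \<and>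
     (\<forall>a b. apart W a b \<longrightarrow> \<sigma> (a \<bowtie>\<^bsub>W\<^esub> b) = \<sigma> a \<bowtie>\<^bsub>W\<^esub> \<sigma> b) \<and>
     (\<forall>s t. same_regions W (\<sigma> s) (\<sigma> t) \<longleftrightarrow> same_regions W s t) \<and>
     (\<forall>s t. evolves W (\<sigma> s) (\<sigma> t) \<longleftrightarrow> evolves W s t) \<and>
     (\<forall>M. p ` M \<in> weights W \<longleftrightarrow> M \<in> weights W) \<and>
     (\<forall>m. constituents W m \<in> weights W \<longrightarrow> potential W (\<sigma> m) = potential W m) \<and>
     (\<forall>A. p ` A \<in> systems W \<longleftrightarrow> A \<in> systems W)"

definition identical_copy ::
    "('p, 's, 'r, 'z) world_scheme \<Rightarrow> 'p set \<Rightarrow> 'p set \<Rightarrow> ('s \<Rightarrow> 's) \<Rightarrow> bool" where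
  "identical_copy W A A' \<sigma> \<longleftrightarrow> A \<inter> A' = {} \<and> (\<exists>p. symmetry W p \<sigma> \<and>
     p ` A = A' \<and> (\<forall>x. p (p x) = x) \<and> (\<forall>x. x \<notin> A \<union> A' \<longrightarrow> p x = x) \<and>
     (\<forall>s. \<sigma> (\<sigma> s) = s) \<and> (\<forall>s. constituents W s \<inter> (A \<union> A') = {} \<longrightarrow> \<sigma> s = s))"


section \<open>Standard processes, the functions \<open>f\<close>, and temperature\<close>

text \<open>The weight process for \<open>XB\<close> from \<open>(x1, b1)\<close> to \<open>(x2, b2)\<close> is standard with respect to \<open>B\<close>.\<close>

definition standard_reversible ::
    "('p, 's, 'r, 'z) world_scheme \<Rightarrow> 's \<Rightarrow> 's \<Rightarrow> 's \<Rightarrow> 's \<Rightarrow> bool" where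
  "standard_reversible W x1 b1 x2 b2 \<longleftrightarrow>
     apart W x1 b1 \<and> constituents W x1 = constituents W x2 \<and>
     SES W b1 \<and> SES W b2 \<and> same_regions W b1 b2 \<and>
     (\<exists>w. reversible_weight_process W (x1 \<bowtie>\<^bsub>W\<^esub> b1) (x2 \<bowtie>\<^bsub>W\<^esub> b2) w)"

definition interconnects_all :: "('p, 's, 'r, 'z) world_scheme \<Rightarrow> 's \<Rightarrow> 's \<Rightarrow> bool" where
  "interconnects_all W x1 b1 \<longleftrightarrow>
     (\<forall>b2. SES W b2 \<and> same_regions W b1 b2 \<longrightarrow> (\<exists>x2. standard_reversible W x1 b1 x2 b2))"

text \<open>
  The graph of the function \<open>f\<close> of the energy of \<open>B\<close> belonging to the initial states \<open>b1\<close> and \<open>c1\<close>.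
  The process for \<open>XB\<close> and the process for \<open>XC\<close> are separate, so \<open>B\<close> and \<open>C\<close> need not be disjoint.
\<close>

definition f_graph ::
    "('p, 's, 'r, 'z) world_scheme \<Rightarrow> ('s \<Rightarrow> real) \<Rightarrow> 's \<Rightarrow> 's \<Rightarrow> (real \<times> real) set" where
  "f_graph W E b1 c1 = {(E b2, E c2) | b2 c2. \<exists>x1 x2.
     constituents W x1 \<in> systems W \<and> apart W x1 b1 \<and> apart W x1 c1 \<and>
     interconnects_all W x1 b1 \<and> interconnects_all W x1 c1 \<and>
     standard_reversible W x1 b1 x2 b2 \<and> standard_reversible W x1 c1 x2 c2}"

definition f_fun ::
    "('p, 's, 'r, 'z) world_scheme \<Rightarrow> ('s \<Rightarrow> real) \<Rightarrow> 's \<Rightarrow> 's \<Rightarrow> real \<Rightarrow> real" where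
  "f_fun W E b1 c1 e = (THE e'. (e, e') \<in> f_graph W E b1 c1)"

abbreviation f_dom ::
    "('p, 's, 'r, 'z) world_scheme \<Rightarrow> ('s \<Rightarrow> real) \<Rightarrow> 's \<Rightarrow> 's \<Rightarrow> real set" where
  "f_dom W E b1 c1 \<equiv> Domain (f_graph W E b1 c1)"

text \<open>
  Temperature relative to the reference state \<open>r1\<close>, to which the value \<open>T1\<close> is assigned. The
  derivative is taken within the domain of \<open>f\<close>, hence is one-sided if, for instance, \<open>b1\<close> has the
  lowest energy.
\<close>

definition temperature ::
    "('p, 's, 'r, 'z) world_scheme \<Rightarrow> ('s \<Rightarrow> real) \<Rightarrow> 's \<Rightarrow> real \<Rightarrow> 's \<Rightarrow> real" where
  "temperature W E r1 T1 b1 =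
     T1 * (THE D. (f_fun W E r1 b1 has_real_derivative D) (at (E r1) within f_dom W E r1 b1))"


section \<open>Parameters\<close>

definition equivalent_SES_set :: "('p, 's, 'r, 'z) world_scheme \<Rightarrow> 'p set \<Rightarrow> 's set \<Rightarrow> bool" where
  "equivalent_SES_set W A P \<longleftrightarrow> (\<forall>a\<in>P. SES W a \<and> constituents W a = A) \<and>
     (\<forall>a\<in>P. \<forall>b\<in>P. a \<noteq> b \<longrightarrow> regions W a \<noteq> regions W b \<and> reversible_weight_process W a b 0)"

text \<open>
  The parameters are functions \<open>\<beta> i\<close> (\<open>i < s\<close>) of the regions of space occupied by the system.
  Equivalent stable equilibrium states have equal energies; so it is together with the energy that
  the parameters distinguish the different sets of equivalent states.
\<close>

definition parametrizes ::
    "('p, 's, 'r, 'z) world_scheme \<Rightarrow> ('s \<Rightarrow> real) \<Rightarrow> 'p set \<Rightarrow> nat set \<Rightarrow> (nat \<Rightarrow> 'r \<Rightarrow> real) \<Rightarrow> bool"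
  where
  "parametrizes W E A I \<beta> \<longleftrightarrow>
     (\<forall>a b. SES W a \<and> SES W b \<and> constituents W a = A \<and> constituents W b = A \<longrightarrow>
        ((\<exists>P. equivalent_SES_set W A P \<and> a \<in> P \<and> b \<in> P) \<longleftrightarrow>
         E a = E b \<and> (\<forall>i\<in>I. \<beta> i (regions W a) = \<beta> i (regions W b))))"

definition parameters ::
    "('p, 's, 'r, 'z) world_scheme \<Rightarrow> ('s \<Rightarrow> real) \<Rightarrow> 'p set \<Rightarrow> nat \<Rightarrow> (nat \<Rightarrow> 'r \<Rightarrow> real) \<Rightarrow> bool"
  where
  "parameters W E A s \<beta> \<longleftrightarrow> parametrizes W E A {..<s} \<beta> \<and>
     (\<forall>I. I \<subset> {..<s} \<longrightarrow> \<not> parametrizes W E A I \<beta>)"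

definition SES_with_parameters ::
    "('p, 's, 'r, 'z) world_scheme \<Rightarrow> 'p set \<Rightarrow> nat \<Rightarrow> (nat \<Rightarrow> 'r \<Rightarrow> real) \<Rightarrow> (nat \<Rightarrow> real) \<Rightarrow> 's set"
  where
  "SES_with_parameters W A s \<beta> v =
     {a. SES W a \<and> constituents W a = A \<and> (\<forall>i<s. \<beta> i (regions W a) = v i)}"


section \<open>The theory\<close>

text \<open>
  Facts about composition, evolution and weight processes that are used tacitly whenever states
  \<open>A\<^sub>1B\<^sub>1\<close> are formed, processes are carried out one after the other, or systems are included in
  the environment.
\<close>

locale world_structure =
  fixes W :: "('p, 's, 'r, 'z) world_scheme" (structure)
  assumes constituents_compose:
      "apart W a b \<Longrightarrow> constituents W (a \<bowtie> b) = constituents W a \<union> constituents W b"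
    and compose_commute: "apart W a b \<Longrightarrow> a \<bowtie> b = b \<bowtie> a"
    and compose_assoc:
      "\<lbrakk>apart W a b; apart W a c; apart W b c\<rbrakk> \<Longrightarrow> (a \<bowtie> b) \<bowtie> c = a \<bowtie> (b \<bowtie> c)"
    and compose_empty: "\<exists>e. constituents W e = {} \<and> (\<forall>a. a \<bowtie> e = a)"
    and compose_cancel:
      "\<lbrakk>apart W a b; constituents W a = constituents W a'; constituents W b = constituents W b';
        a \<bowtie> b = a' \<bowtie> b'\<rbrakk> \<Longrightarrow> a = a' \<and> b = b'"
    and regions_compose:
      "\<lbrakk>apart W a b; constituents W a = constituents W a'; constituents W b = constituents W b'\<rbrakk>
        \<Longrightarrow> regions W (a \<bowtie> b) = regions W (a' \<bowtie> b')
            \<longleftrightarrow> regions W a = regions W a' \<and> regions W b = regions W b'"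
    and constituents_evolves: "evolves W s t \<Longrightarrow> constituents W s = constituents W t"
    \<comment> \<open>translation along the force field is the only change of an elementary mechanical system\<close>
    and potential_inject:
      "\<lbrakk>constituents W m \<in> weights W; constituents W m = constituents W m';
        potential W m = potential W m'\<rbrakk> \<Longrightarrow> m = m'"
    and systems_Un: "\<lbrakk>A \<in> systems W; B \<in> systems W; A \<inter> B = {}\<rbrakk> \<Longrightarrow> A \<union> B \<in> systems W"
    \<comment> \<open>copies can be included in the environment of any finite number of systems\<close>
    and copies_exist:
      "\<lbrakk>A \<in> systems W; finite \<B>; \<B> \<subseteq> systems W\<rbrakk>
        \<Longrightarrow> \<exists>A' \<sigma>. identical_copy W A A' \<sigma> \<and> A' \<inter> \<Union>\<B> = {}"
    and weight_process_trans:
      "\<lbrakk>constituents W a \<in> systems W; weight_process W a b v; weight_process W b c w\<rbrakk>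
        \<Longrightarrow> weight_process W a c (v + w)"
    \<comment> \<open>a further system may stay in an equilibrium state meanwhile\<close>
    and weight_process_idle:
      "\<lbrakk>constituents W a \<in> systems W; constituents W c \<in> systems W; apart W a c;
        equilibrium W c; weight_process W a b w\<rbrakk> \<Longrightarrow> weight_process W (a \<bowtie> c) (b \<bowtie> c) w"

text \<open>
  \<open>E\<close> is the energy function, with arbitrarily chosen reference values, and \<open>r1\<close> is the reference
  state, to which the temperature \<open>T1\<close> is assigned. In \<open>f_defined\<close> one cannot ask for energies below
  \<open>E b\<close> if \<open>b\<close> or \<open>c\<close> has the lowest energy, since \<open>f\<close> is increasing. Likewise \<open>f_differentiable\<close>
  is not required at a lowest-energy state \<open>b\<close> other than \<open>r1\<close>: differentiability there would entail
  that the temperature never vanishes. By \<open>SES_unique\<close> a stable equilibrium state, and with it the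
  temperature, is a function of the energy and the regions of space.
\<close>

locale thermodynamics = world_structure +
  fixes E :: "'s \<Rightarrow> real" and r1 :: 's and T1 :: real
  assumes weight_polygonal_exists:
      "\<lbrakk>constituents W a \<in> systems W; constituents W a = constituents W b\<rbrakk>
        \<Longrightarrow> \<exists>w. weight_polygonal W a b w"
    and work_unique:
      "\<lbrakk>constituents W a \<in> systems W; weight_polygonal W a b v; weight_polygonal W a b w\<rbrakk>
        \<Longrightarrow> v = w"
    and energy_difference:
      "\<lbrakk>constituents W a \<in> systems W; weight_polygonal W a b w\<rbrakk> \<Longrightarrow> E b - E a = - w"
    and SES_exists:
      "constituents W a \<in> systems W \<Longrightarrow> \<exists>b. SES W b \<and> same_regions W a b \<and> E b = E a"
    and SES_unique: "\<lbrakk>SES W a; SES W b; same_regions W a b; E a = E b\<rbrakk> \<Longrightarrow> a = b"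
    and relax_to_SES:
      "constituents W a \<in> systems W
        \<Longrightarrow> \<exists>b. SES W b \<and> same_regions W a b \<and> E b = E a \<and> weight_process W a b 0"
    and raise_energy:
      "\<lbrakk>constituents W a \<in> systems W; E a < e\<rbrakk>
        \<Longrightarrow> \<exists>b w. weight_process W a b w \<and> same_regions W a b \<and> E b = e \<and> \<not> equilibrium W b"
    and copy_mutual_SES:
      "\<lbrakk>SES W a; identical_copy W (constituents W a) A' \<sigma>\<rbrakk> \<Longrightarrow> mutual_SES W a (\<sigma> a)"
    and reversible_interconnection:
      "\<lbrakk>constituents W a1 \<in> systems W; constituents W a1 = constituents W a2\<rbrakk>
        \<Longrightarrow> \<exists>b1 b2. standard_reversible W a1 b1 a2 b2"
    and f_defined:
      "\<lbrakk>SES W b; SES W c\<rbrakk> \<Longrightarrow> \<exists>\<epsilon>>0. {E b ..< E b + \<epsilon>} \<subseteq> f_dom W E b c \<and>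
        (\<not> lowest_SES W E b \<and> \<not> lowest_SES W E c \<longrightarrow> {E b - \<epsilon> <.. E b} \<subseteq> f_dom W E b c)"
    and f_differentiable:
      "\<lbrakk>SES W b; SES W c; \<not> lowest_SES W E b \<or> b = r1\<rbrakk>
        \<Longrightarrow> f_fun W E b c differentiable (at (E b) within f_dom W E b c)"
    and reference: "SES W r1" "T1 > 0"
    and temperature_continuous:
      "A \<in> systems W \<Longrightarrow>
        continuous_on {E b | b. SES W b \<and> constituents W b = A \<and> regions W b = \<rho>}
          (\<lambda>e. temperature W E r1 T1
             (THE b. SES W b \<and> constituents W b = A \<and> regions W b = \<rho> \<and> E b = e))"
    and temperature_vanishing:
      "\<lbrakk>SES W b; temperature W E r1 T1 b = 0\<rbrakk> \<Longrightarrow> lowest_SES W E b"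

end

theory Submission
  imports Defs
begin

text \<open>
  Call two states interaccessible if each can be reached from the other by a weight process. A
  catalyst, i.e. a system that returns to its initial state, can be counted among the environment,
  so equality of the entropy changes \<open>b1 \<rightarrow> b2\<close> and \<open>c1 \<rightarrow> c2\<close> is expressed by interaccessibility of
  \<open>b1 \<bowtie> c2\<close> and \<open>b2 \<bowtie> c1\<close>. The functions \<open>f\<close> describe this relation locally and their derivatives
  are quotients of temperatures; integration along the curves of constant entropy shows that the
  relation holds whenever \<open>S = \<integral>dE / T\<close> changes by equal amounts.

  By Postulate 4 a system and its copy, both in the state of energy \<open>p\<close>, are in mutual stable
  equilibrium, and the energy of this state cannot be lowered at constant entropy and regions.
  Therefore, of two equal consecutive increments of \<open>S\<close>, the second takes more energy. Hence \<open>S\<close> is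
  strictly concave and \<open>T = dE / dS\<close> strictly increasing; continuity of \<open>T\<close> covers the state of
  lowest energy. Finally, equivalent states have equal temperatures because to each of them belongs
  the same function \<open>f\<close>, so that the regions of space matter only through the parameters.
\<close>

section \<open>Accessibility by weight processes\<close>

definition accessible :: "('p, 's, 'r, 'z) world_scheme \<Rightarrow> 's \<Rightarrow> 's \<Rightarrow> bool" where
  "accessible W a b \<longleftrightarrow> (\<exists>w. weight_process W a b w)"

text \<open>The two directions may use different environments and weights, so this is weaker than
  \<open>reversible_weight_process\<close>; in return it inherits transitivity from
  \<open>weight_process_trans\<close>.\<close>

definition interaccessible :: "('p, 's, 'r, 'z) world_scheme \<Rightarrow> 's \<Rightarrow> 's \<Rightarrow> bool" where
  "interaccessible W a b \<longleftrightarrow> accessible W a b \<and> accessible W b a"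

lemma interaccessible_sym: "interaccessible W a b \<Longrightarrow> interaccessible W b a"
  by (simp add: interaccessible_def)

lemma accessible_constituents: "accessible W a b \<Longrightarrow> constituents W b = constituents W a"
  by (auto simp: accessible_def weight_process_def weight_setting_def)

lemma interaccessible_constituents: "interaccessible W a b \<Longrightarrow> constituents W b = constituents W a"
  by (auto simp: interaccessible_def dest: accessible_constituents)

lemma reversible_interaccessible:
  assumes "reversible_weight_process W a b w"
  shows "interaccessible W a b"
proof -
  obtain n m m' where *: "weight_setting W a b n m m' w"
     "evolves W (a \<bowtie>\<^bsub>W\<^esub> (n \<bowtie>\<^bsub>W\<^esub> m)) (b \<bowtie>\<^bsub>W\<^esub> (n \<bowtie>\<^bsub>W\<^esub> m'))"
     "evolves W (b \<bowtie>\<^bsub>W\<^esub> (n \<bowtie>\<^bsub>W\<^esub> m')) (a \<bowtie>\<^bsub>W\<^esub> (n \<bowtie>\<^bsub>W\<^esub> m))"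
    using assms by (auto simp: reversible_weight_process_def)
  moreover from *(1) have "weight_setting W b a n m' m (- w)"
    by (auto simp: weight_setting_def apart_def)
  ultimately show ?thesis
    unfolding interaccessible_def accessible_def weight_process_def by blast
qed

lemma same_regions_sym: "same_regions W a b \<Longrightarrow> same_regions W b a"
  by (simp add: same_regions_def)

lemma same_regions_trans: "same_regions W a b \<Longrightarrow> same_regions W b c \<Longrightarrow> same_regions W a c"
  by (simp add: same_regions_def)

section \<open>Composition, idle systems and catalysts\<close>

context world_structure
begin

lemma apart_compose [simp]:
  "apart W a b \<Longrightarrow> apart W (a \<bowtie> b) c \<longleftrightarrow> apart W a c \<and> apart W b c"
  "apart W a b \<Longrightarrow> apart W c (a \<bowtie> b) \<longleftrightarrow> apart W c a \<and> apart W c b"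
  using constituents_compose[of a b] by (auto simp: apart_def)

lemma apart_sym: "apart W a b \<Longrightarrow> apart W b a"
  by (auto simp: apart_def)

lemma compose_systems:
  "\<lbrakk>constituents W a \<in> systems W; constituents W b \<in> systems W; apart W a b\<rbrakk>
    \<Longrightarrow> constituents W (a \<bowtie> b) \<in> systems W"
  by (simp add: constituents_compose systems_Un apart_def)

lemma compose_left_commute:
  assumes "apart W a b" "apart W a c" "apart W b c"
  shows "a \<bowtie> (b \<bowtie> c) = b \<bowtie> (a \<bowtie> c)"
  by (metis assms compose_assoc compose_commute apart_sym)

lemma accessible_trans:
  "\<lbrakk>constituents W a \<in> systems W; accessible W a b; accessible W b c\<rbrakk> \<Longrightarrow> accessible W a c"
  unfolding accessible_def using weight_process_trans by blast

lemma interaccessible_trans: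
  assumes "constituents W a \<in> systems W" "interaccessible W a b" "interaccessible W b c"
  shows "interaccessible W a c"
  using assms accessible_trans[of a b c] accessible_trans[of c b a]
    interaccessible_constituents[of W a b] interaccessible_constituents[of W b c]
  by (auto simp: interaccessible_def)

lemma accessible_idle:
  assumes "constituents W a \<in> systems W" "SES W c" "apart W a c" "accessible W a b"
  shows "accessible W (a \<bowtie> c) (b \<bowtie> c)"
  using assms weight_process_idle unfolding accessible_def SES_def by blast

lemma interaccessible_idle:
  assumes "constituents W a \<in> systems W" "SES W c" "apart W a c" "interaccessible W a b"
  shows "interaccessible W (a \<bowtie> c) (b \<bowtie> c)"
proof -
  have eq: "constituents W b = constituents W a"
    by (rule interaccessible_constituents[OF assms(4)])
  then have "apart W b c" "constituents W b \<in> systems W"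
    using assms by (simp_all add: apart_def)
  then show ?thesis
    using assms(2-4) accessible_idle[OF assms(1-3)] accessible_idle[of b c a]
    unfolding interaccessible_def by blast
qed

lemma interaccessible_idle':
  assumes "constituents W a \<in> systems W" "SES W c" "apart W a c" "interaccessible W a b"
  shows "interaccessible W (c \<bowtie> a) (c \<bowtie> b)"
proof -
  have "apart W b c"
    using assms interaccessible_constituents[of W a b] by (simp add: apart_def)
  then show ?thesis
    using interaccessible_idle[OF assms] compose_commute[OF assms(3)] compose_commute[of b c] by simp
qed

text \<open>A system that ends where it started may be counted among the environment.\<close>

lemma accessible_drop:
  assumes "accessible W (a \<bowtie> c) (b \<bowtie> c)" "apart W a c" "constituents W b = constituents W a"
  shows "accessible W a b"
proof -
  obtain n m m' w where s: "weight_setting W (a \<bowtie> c) (b \<bowtie> c) n m m' w"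
    and e: "evolves W (a \<bowtie> c \<bowtie> (n \<bowtie> m)) (b \<bowtie> c \<bowtie> (n \<bowtie> m'))"
    using assms(1) by (auto simp: accessible_def weight_process_def)
  have bc: "apart W b c" using assms by (simp add: apart_def)
  have ap: "apart W a n" "apart W a m" "apart W c n" "apart W c m" "apart W n m"
       "apart W b n" "apart W b m'" "apart W c m'" "apart W n m'" "apart W a m'"
    using s assms(2,3) bc unfolding weight_setting_def
    by (auto simp: constituents_compose apart_def)
  have "weight_setting W a b (c \<bowtie> n) m m' w"
    using s assms(2,3) ap by (auto simp: weight_setting_def)
  moreover have "a \<bowtie> c \<bowtie> (n \<bowtie> m) = a \<bowtie> ((c \<bowtie> n) \<bowtie> m)"
    using ap assms(2) by (simp add: compose_assoc)
  moreover have "b \<bowtie> c \<bowtie> (n \<bowtie> m') = b \<bowtie> ((c \<bowtie> n) \<bowtie> m')"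
    using ap bc by (simp add: compose_assoc)
  ultimately have "weight_process W a b w"
    using e unfolding weight_process_def by (intro exI[of _ "c \<bowtie> n"] exI[of _ m] exI[of _ m']) simp
  then show ?thesis
    by (auto simp: accessible_def)
qed

lemma interaccessible_drop:
  assumes "interaccessible W (a \<bowtie> c) (b \<bowtie> c)" "apart W a c" "constituents W b = constituents W a"
  shows "interaccessible W a b"
proof -
  have "apart W b c" using assms by (simp add: apart_def)
  then show ?thesis
    using assms accessible_drop[of a c b] accessible_drop[of b c a]
    unfolding interaccessible_def by metis
qed

lemma interaccessible_drop':
  assumes "interaccessible W (c \<bowtie> a) (c \<bowtie> b)" "apart W a c" "constituents W b = constituents W a"
  shows "interaccessible W a b"
proof -
  have "apart W b c" using assms by (simp add: apart_def)
  then show ?thesis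
    using assms interaccessible_drop[of a c b] compose_commute[of a c] compose_commute[of b c]
    by simp
qed

section \<open>Symmetries and identical copies\<close>

lemma weight_process_image:
  assumes \<sigma>: "symmetry W p \<sigma>" and "weight_process W a b w"
  shows "weight_process W (\<sigma> a) (\<sigma> b) w"
proof -
  obtain n m m' where s: "weight_setting W a b n m m' w"
    and e: "evolves W (a \<bowtie> (n \<bowtie> m)) (b \<bowtie> (n \<bowtie> m'))"
    using assms(2) by (auto simp: weight_process_def)
  have inj: "inj p" using \<sigma> by (simp add: symmetry_def bij_is_inj)
  have ap: "apart W (\<sigma> s) (\<sigma> t) \<longleftrightarrow> apart W s t" for s t
    using \<sigma> by (auto simp: symmetry_def apart_def image_Int[OF inj, symmetric])
  have "weight_setting W (\<sigma> a) (\<sigma> b) (\<sigma> n) (\<sigma> m) (\<sigma> m') w"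
    using s \<sigma> unfolding weight_setting_def ap by (auto simp: symmetry_def)
  moreover have "\<sigma> (a \<bowtie> (n \<bowtie> m)) = \<sigma> a \<bowtie> (\<sigma> n \<bowtie> \<sigma> m)"
    using s \<sigma> by (simp add: weight_setting_def symmetry_def)
  moreover have "\<sigma> (b \<bowtie> (n \<bowtie> m')) = \<sigma> b \<bowtie> (\<sigma> n \<bowtie> \<sigma> m')"
  proof -
    have "apart W b n" "apart W b m'" "apart W n m'"
      using s by (auto simp: weight_setting_def apart_def)
    then show ?thesis using \<sigma> by (simp add: symmetry_def)
  qed
  moreover have "evolves W (\<sigma> (a \<bowtie> (n \<bowtie> m))) (\<sigma> (b \<bowtie> (n \<bowtie> m')))"
    using e \<sigma> by (simp add: symmetry_def)
  ultimately show ?thesis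
    unfolding weight_process_def by (intro exI[of _ "\<sigma> n"] exI[of _ "\<sigma> m"] exI[of _ "\<sigma> m'"]) simp
qed

lemma copy_symmetry: "identical_copy W A A' \<sigma> \<Longrightarrow> \<exists>p. symmetry W p \<sigma> \<and> p ` A = A'"
  unfolding identical_copy_def by (elim conjE exE, intro exI conjI)

lemma copy_weight_process:
  "identical_copy W A A' \<sigma> \<Longrightarrow> weight_process W a b w \<Longrightarrow> weight_process W (\<sigma> a) (\<sigma> b) w"
  using copy_symmetry weight_process_image by blast

lemma copy_involutive: "identical_copy W A A' \<sigma> \<Longrightarrow> \<sigma> (\<sigma> s) = s"
  unfolding identical_copy_def by blast

lemma copy_disjoint: "identical_copy W A A' \<sigma> \<Longrightarrow> A \<inter> A' = {}"
  unfolding identical_copy_def by blast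

lemma copy_fixes:
  "identical_copy W A A' \<sigma> \<Longrightarrow> constituents W s \<inter> A = {} \<Longrightarrow> constituents W s \<inter> A' = {} \<Longrightarrow> \<sigma> s = s"
  unfolding identical_copy_def by blast

lemma copy_constituents:
  assumes "identical_copy W A A' \<sigma>" "constituents W s = A"
  shows "constituents W (\<sigma> s) = A'"
proof -
  obtain p where p: "symmetry W p \<sigma>" "p ` A = A'"
    using assms copy_symmetry by blast
  from p(1) have "constituents W (\<sigma> s) = p ` constituents W s" by (simp add: symmetry_def)
  then show ?thesis using p assms by simp
qed

lemma copy_compose:
  assumes "identical_copy W A A' \<sigma>" "apart W a b"
  shows "\<sigma> (a \<bowtie> b) = \<sigma> a \<bowtie> \<sigma> b"
proof -
  obtain p where "symmetry W p \<sigma>" using assms(1) copy_symmetry by blast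
  then show ?thesis using assms(2) by (simp add: symmetry_def)
qed

lemma copy_same_regions:
  assumes "identical_copy W A A' \<sigma>"
  shows "same_regions W (\<sigma> a) (\<sigma> b) \<longleftrightarrow> same_regions W a b"
proof -
  obtain p where "symmetry W p \<sigma>" using assms(1) copy_symmetry by blast
  then show ?thesis by (simp add: symmetry_def)
qed

lemma copy_systems:
  assumes "identical_copy W A A' \<sigma>"
  shows "A' \<in> systems W \<longleftrightarrow> A \<in> systems W"
proof -
  obtain p where p: "symmetry W p \<sigma>" "p ` A = A'"
    using assms copy_symmetry by blast
  from p(1) have "p ` A \<in> systems W \<longleftrightarrow> A \<in> systems W" by (simp add: symmetry_def)
  then show ?thesis using p by simp
qed

lemma copy_interaccessible:
  "identical_copy W A A' \<sigma> \<Longrightarrow> interaccessible W (\<sigma> a) (\<sigma> b) \<longleftrightarrow> interaccessible W a b"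
  unfolding interaccessible_def accessible_def
  using copy_weight_process copy_involutive by metis

lemma copy_accessible:
  "identical_copy W A A' \<sigma> \<Longrightarrow> accessible W (\<sigma> a) (\<sigma> b) \<longleftrightarrow> accessible W a b"
  unfolding accessible_def using copy_weight_process copy_involutive by metis

text \<open>A change that would violate the stability of \<open>\<sigma> a\<close> is carried by
  \<open>\<sigma>\<close> to one that violates the stability of \<open>a\<close>; the involution
  property lets every competing state and every environment be written as an image.\<close>

lemma SES_image:
  assumes \<sigma>: "symmetry W p \<sigma>" and "\<And>s. \<sigma> (\<sigma> s) = s" and "SES W a"
  shows "SES W (\<sigma> a)"
proof -
  have inj: "inj p" using \<sigma> by (simp add: symmetry_def bij_is_inj)
  have ap: "apart W (\<sigma> s) (\<sigma> t) \<longleftrightarrow> apart W s t" for s t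
    using \<sigma> by (auto simp: symmetry_def apart_def image_Int[OF inj, symmetric])
  have ev: "evolves W (\<sigma> s) (\<sigma> t) \<longleftrightarrow> evolves W s t" for s t
    using \<sigma> by (simp add: symmetry_def)
  have sr: "same_regions W (\<sigma> s) (\<sigma> t) \<longleftrightarrow> same_regions W s t" for s t
    using \<sigma> by (simp add: symmetry_def)
  have "constituents W (\<sigma> a) \<in> systems W"
    using \<sigma> assms(3) by (simp add: symmetry_def SES_def)
  moreover have "equilibrium W (\<sigma> a)"
    using assms(3) unfolding SES_def equilibrium_def by (metis assms(2) ev)
  moreover have "b = \<sigma> a"
    if h: "apart W (\<sigma> a) n" "same_regions W (\<sigma> a) b" "evolves W (\<sigma> a \<bowtie> n) (b \<bowtie> n)" for b n
  proof -
    have 1: "apart W a (\<sigma> n)" "same_regions W a (\<sigma> b)"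
      using h ap sr assms(2) by metis+
    then have "apart W (\<sigma> b) (\<sigma> n)" by (simp add: apart_def same_regions_def)
    then have "evolves W (\<sigma> (a \<bowtie> \<sigma> n)) (\<sigma> (\<sigma> b \<bowtie> \<sigma> n))"
      using h(3) 1 \<sigma> assms(2) by (simp add: symmetry_def)
    then have "\<sigma> b = a"
      using 1 assms(3) unfolding SES_def ev by blast
    then show ?thesis using assms(2) by metis
  qed
  ultimately show ?thesis unfolding SES_def by blast
qed

lemma copy_SES: "identical_copy W A A' \<sigma> \<Longrightarrow> SES W a \<Longrightarrow> SES W (\<sigma> a)"
  using SES_image copy_symmetry copy_involutive by blast

lemma SES_systems: "SES W a \<Longrightarrow> constituents W a \<in> systems W"
  by (simp add: SES_def)

text \<open>
  If the same change of an auxiliary system compensates the change of \<open>b\<close> and that of \<open>c\<close>, then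
  the auxiliary system acts as a catalyst in transferring entropy between \<open>b\<close> and \<open>c\<close>.
\<close>

lemma interaccessible_via:
  assumes "interaccessible W (x1 \<bowtie> b1) (x2 \<bowtie> b2)" "interaccessible W (x1 \<bowtie> c1) (x2 \<bowtie> c2)"
    and "apart W x1 b1" "apart W x1 c1" "apart W b1 c1"
    and "constituents W x2 = constituents W x1" "constituents W b2 = constituents W b1"
        "constituents W c2 = constituents W c1"
    and "constituents W x1 \<in> systems W" "SES W c2" "SES W b2"
  shows "interaccessible W (b1 \<bowtie> c2) (b2 \<bowtie> c1)"
proof -
  have ap: "apart W x1 b2" "apart W x1 c2" "apart W x2 b1" "apart W x2 b2" "apart W x2 c1"
      "apart W x2 c2" "apart W b1 c2" "apart W b2 c1" "apart W b2 c2"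
    and ap': "apart W b2 x2" "apart W b2 x1" "apart W c1 b2" "apart W c2 b2"
    using assms(3-8) by (auto simp: apart_def)
  note ap = assms(3-5) ap ap'
  have sy: "constituents W b1 \<in> systems W" "constituents W b2 \<in> systems W"
     "constituents W c1 \<in> systems W" "constituents W c2 \<in> systems W" "constituents W x2 \<in> systems W"
    using SES_systems[OF assms(10)] SES_systems[OF assms(11)] assms(6-9) by simp_all
  note sy = sy assms(9)
  \<comment> \<open>The first process runs forward with \<open>c2\<close> idle, then the second runs
    backward with \<open>b2\<close> idle. This returns the auxiliary system to \<open>x1\<close>,
    which can then be dropped.\<close>
  have "interaccessible W ((x1 \<bowtie> b1) \<bowtie> c2) ((x2 \<bowtie> b2) \<bowtie> c2)"
    by (rule interaccessible_idle[OF _ assms(10) _ assms(1)]) (simp_all add: compose_systems ap sy)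
  moreover have "interaccessible W (b2 \<bowtie> (x2 \<bowtie> c2)) (b2 \<bowtie> (x1 \<bowtie> c1))"
    by (rule interaccessible_idle'[OF _ assms(11) _ interaccessible_sym[OF assms(2)]])
      (simp_all add: compose_systems ap sy apart_sym)
  moreover have "(x2 \<bowtie> b2) \<bowtie> c2 = b2 \<bowtie> (x2 \<bowtie> c2)"
    using ap by (simp add: compose_assoc compose_left_commute)
  moreover have "constituents W ((x1 \<bowtie> b1) \<bowtie> c2) \<in> systems W"
    by (simp add: compose_systems ap sy)
  ultimately have "interaccessible W ((x1 \<bowtie> b1) \<bowtie> c2) (b2 \<bowtie> (x1 \<bowtie> c1))"
    using interaccessible_trans by simp
  moreover have "(x1 \<bowtie> b1) \<bowtie> c2 = x1 \<bowtie> (b1 \<bowtie> c2)"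
    using ap by (simp add: compose_assoc)
  moreover have "b2 \<bowtie> (x1 \<bowtie> c1) = x1 \<bowtie> (b2 \<bowtie> c1)"
    using ap by (simp add: compose_left_commute)
  ultimately have "interaccessible W (x1 \<bowtie> (b1 \<bowtie> c2)) (x1 \<bowtie> (b2 \<bowtie> c1))"
    by simp
  then show ?thesis
    by (rule interaccessible_drop') (simp_all add: constituents_compose ap apart_sym assms(7,8))
qed

end

section \<open>Second law: accessibility and energy of stable equilibrium states\<close>

context thermodynamics
begin

lemma energy_balance:
  "\<lbrakk>constituents W a \<in> systems W; weight_process W a b w\<rbrakk> \<Longrightarrow> E b - E a = - w"
  using energy_difference[of a b w] weight_polygonal.forward[OF weight_polygonal.start, of W a b w] by simp

text \<open>Equal energies mean zero work, so by \<open>potential_inject\<close> the weight returns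
  to its initial state. The whole environment is then unchanged, which is the situation excluded by
  the definition of \<open>SES\<close>.\<close>

lemma SES_accessible_same_energy:
  assumes "SES W a" "same_regions W a b" "accessible W a b" "E b = E a"
  shows "b = a"
proof -
  obtain w where w: "weight_process W a b w" using assms(3) by (auto simp: accessible_def)
  then have "w = 0" using energy_balance[OF SES_systems[OF assms(1)] w] assms(4) by simp
  then obtain n m m' where s: "weight_setting W a b n m m' 0"
     and e: "evolves W (a \<bowtie> (n \<bowtie> m)) (b \<bowtie> (n \<bowtie> m'))"
    using w by (auto simp: weight_process_def)
  from s have ap: "apart W a n" "apart W a m" "apart W n m" by (simp_all add: weight_setting_def)
  have "m = m'"
    using s potential_inject unfolding weight_setting_def by (metis cancel_comm_monoid_add_class.diff_cancel eq_iff_diff_eq_0)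
  with e have "evolves W (a \<bowtie> (n \<bowtie> m)) (b \<bowtie> (n \<bowtie> m))" by simp
  moreover have "apart W a (n \<bowtie> m)" using ap by simp
  ultimately show ?thesis
    using assms(1,2) unfolding SES_def by blast
qed

text \<open>
  Impossibility of a perpetual motion machine of the second kind: otherwise the work gained could
  be used to raise the final state to a non-equilibrium state with the energy of \<open>a\<close>.
\<close>

lemma SES_accessible_energy_le:
  assumes "SES W a" "same_regions W a b" "accessible W a b"
  shows "E a \<le> E b"
proof (rule ccontr)
  assume "\<not> E a \<le> E b"
  then have less: "E b < E a" by simp
  have "constituents W b \<in> systems W"
    using assms(2) SES_systems[OF assms(1)] by (simp add: same_regions_def)
  then obtain c w where c: "weight_process W b c w" "same_regions W b c" "E c = E a" "\<not> equilibrium W c"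
    using raise_energy[OF _ less] by blast
  have "accessible W a c"
    using accessible_trans[OF SES_systems[OF assms(1)] assms(3)] c(1) by (auto simp: accessible_def)
  then have "c = a"
    using SES_accessible_same_energy[OF assms(1) same_regions_trans[OF assms(2) c(2)]] c(3) by blast
  then show False using assms(1) c(4) by (simp add: SES_def)
qed

text \<open>Raise the energy by a weight process, then relax at zero work; uniqueness identifies the
  end state with \<open>b\<close>. Together with \<open>SES_accessible_energy_le\<close>,
  accessibility between stable states in the same regions is the order of their energies.\<close>

lemma SES_accessible:
  assumes "SES W a" "SES W b" "same_regions W a b" "E a \<le> E b"
  shows "accessible W a b"
proof (cases "E a = E b")
  case True
  then have "b = a" using SES_unique assms by metis
  \<comment> \<open>A weight process from \<open>a\<close> to itself comes from relaxation: its end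
    state has the energy and regions of \<open>a\<close>, hence is \<open>a\<close>.\<close>
  moreover obtain c where "SES W c" "same_regions W a c" "E c = E a" "weight_process W a c 0"
    using relax_to_SES[OF SES_systems[OF assms(1)]] by blast
  moreover have "c = a" using SES_unique assms(1) calculation by metis
  ultimately show ?thesis by (auto simp: accessible_def)
next
  case False
  then obtain c w where c: "weight_process W a c w" "same_regions W a c" "E c = E b"
    using raise_energy[OF SES_systems[OF assms(1)]] assms(4) by (metis less_eq_real_def)
  have "constituents W c \<in> systems W" using c(2) SES_systems[OF assms(1)] by (simp add: same_regions_def)
  then obtain d where d: "SES W d" "same_regions W c d" "E d = E c" "weight_process W c d 0"
    using relax_to_SES by blast
  have "same_regions W d b" using c d assms(3) by (simp add: same_regions_def)
  then have "d = b" using SES_unique[OF d(1) assms(2)] d(3) c(3) by simp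
  then show ?thesis
    using accessible_trans[OF SES_systems[OF assms(1)], of c b] c(1) d(4) by (auto simp: accessible_def)
qed

lemma SES_interaccessible_refl: "SES W a \<Longrightarrow> interaccessible W a a"
  using SES_accessible[of a a] by (simp add: interaccessible_def same_regions_def)

lemma accessible_if_compensated:
  assumes c: "SES W c" "SES W d" "SES W c'" "SES W d'"
    and eq: "constituents W c' = constituents W c" "constituents W d' = constituents W d"
    and ap: "apart W c d" "apart W c y" "apart W d y"
    and y: "SES W y" "SES W y'" "same_regions W y y'" "E y' \<le> E y"
    and acc: "accessible W ((c \<bowtie> d) \<bowtie> y) ((c' \<bowtie> d') \<bowtie> y')"
  shows "accessible W (c \<bowtie> d) (c' \<bowtie> d')"
proof -
  note sy = SES_systems[OF c(1)] SES_systems[OF c(2)] SES_systems[OF y(1)]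
  have eqy: "constituents W y' = constituents W y" using y(3) by (simp add: same_regions_def)
  have ap': "apart W c' d'" "apart W c' y" "apart W d' y" "apart W c' y'" "apart W d' y'"
    "apart W y d'" "apart W y' d'" "apart W y' c'" "apart W y c'"
    using ap eq eqy by (auto simp: apart_def)
  have "accessible W y' y" by (rule SES_accessible[OF y(2,1) same_regions_sym[OF y(3)] y(4)])
  then have "accessible W (y' \<bowtie> c') (y \<bowtie> c')"
    by (rule accessible_idle[rotated 3]) (use sy ap' eqy c in simp_all)
  then have "accessible W ((y' \<bowtie> c') \<bowtie> d') ((y \<bowtie> c') \<bowtie> d')"
    by (rule accessible_idle[rotated 3]) (use sy ap' eqy eq c compose_systems in simp_all)
  moreover have "(y' \<bowtie> c') \<bowtie> d' = (c' \<bowtie> d') \<bowtie> y'" "(y \<bowtie> c') \<bowtie> d' = (c' \<bowtie> d') \<bowtie> y"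
    using ap' by (simp_all add: compose_assoc compose_commute[of y'] compose_commute[of y])
  ultimately have "accessible W ((c' \<bowtie> d') \<bowtie> y') ((c' \<bowtie> d') \<bowtie> y)" by simp
  then have "accessible W ((c \<bowtie> d) \<bowtie> y) ((c' \<bowtie> d') \<bowtie> y)"
    by (rule accessible_trans[rotated 2, OF _]) (use sy ap acc compose_systems in simp_all)
  then show ?thesis
    by (rule accessible_drop) (use ap ap' eq in \<open>simp_all add: constituents_compose\<close>)
qed

text \<open>A reversible standard process joins the two composite states at the expense of an
  auxiliary system. According to the sign of the energy change of the latter, one of the two
  directions can do without it.\<close>

lemma accessible_total:
  assumes c: "SES W c" "SES W d" "SES W c'" "SES W d'"
    and eq: "constituents W c' = constituents W c" "constituents W d' = constituents W d"
    and ap: "apart W c d"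
  shows "accessible W (c \<bowtie> d) (c' \<bowtie> d') \<or> accessible W (c' \<bowtie> d') (c \<bowtie> d)"
proof -
  have ap': "apart W c' d'" using ap eq by (simp add: apart_def)
  have "constituents W (c \<bowtie> d) \<in> systems W" by (intro compose_systems SES_systems c ap)
  moreover have "constituents W (c \<bowtie> d) = constituents W (c' \<bowtie> d')"
    using ap ap' eq by (simp add: constituents_compose)
  ultimately obtain y y' where st: "standard_reversible W (c \<bowtie> d) y (c' \<bowtie> d') y'"
    using reversible_interconnection by blast
  then have y: "SES W y" "SES W y'" "same_regions W y y'" "apart W c y" "apart W d y"
    and acc: "accessible W ((c \<bowtie> d) \<bowtie> y) ((c' \<bowtie> d') \<bowtie> y')" "accessible W ((c' \<bowtie> d') \<bowtie> y') ((c \<bowtie> d) \<bowtie> y)"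
    using ap reversible_interaccessible[of W]
    by (auto simp: standard_reversible_def interaccessible_def)
  have y': "apart W c' y'" "apart W d' y'"
    using y eq by (simp_all add: apart_def same_regions_def)
  show ?thesis
  proof (cases "E y' \<le> E y")
    case True
    then show ?thesis using accessible_if_compensated[OF c eq ap y(4,5,1,2,3) True acc(1)] by simp
  next
    case False
    then have le: "E y \<le> E y'" by simp
    show ?thesis
      using accessible_if_compensated[OF c(3,4,1,2) eq(1,2)[symmetric] ap' y' y(2,1) same_regions_sym[OF y(3)] le acc(2)]
      by simp
  qed
qed

text \<open>The exchange of the states of two identical copies is a symmetry, so it is reversible.\<close>

lemma copy_swap:
  assumes \<tau>: "identical_copy W C C' \<tau>" and "SES W c1" "SES W c2"
    and "constituents W c1 = C" "constituents W c2 = C"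
  shows "interaccessible W (c1 \<bowtie> \<tau> c2) (c2 \<bowtie> \<tau> c1)"
proof -
  have C: "constituents W (\<tau> c1) = C'" "constituents W (\<tau> c2) = C'"
    using copy_constituents[OF \<tau>] assms by simp_all
  have ap: "apart W c1 (\<tau> c2)" "apart W c2 (\<tau> c1)"
    using C assms copy_disjoint[OF \<tau>] by (simp_all add: apart_def)
  \<comment> \<open>The symmetry \<open>\<tau>\<close> interchanges the two composite states, so
    accessibility in one direction is equivalent to accessibility in the other;
    \<open>accessible_total\<close> supplies one of them.\<close>
  have "\<tau> (c1 \<bowtie> \<tau> c2) = c2 \<bowtie> \<tau> c1" "\<tau> (c2 \<bowtie> \<tau> c1) = c1 \<bowtie> \<tau> c2"
    using ap copy_involutive[OF \<tau>] copy_compose[OF \<tau>] compose_commute apart_sym by metis+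
  then have "accessible W (c1 \<bowtie> \<tau> c2) (c2 \<bowtie> \<tau> c1) \<longleftrightarrow> accessible W (c2 \<bowtie> \<tau> c1) (c1 \<bowtie> \<tau> c2)"
    using copy_accessible[OF \<tau>, of "c1 \<bowtie> \<tau> c2" "c2 \<bowtie> \<tau> c1"] by simp
  moreover have "accessible W (c1 \<bowtie> \<tau> c2) (c2 \<bowtie> \<tau> c1) \<or> accessible W (c2 \<bowtie> \<tau> c1) (c1 \<bowtie> \<tau> c2)"
    by (rule accessible_total) (use ap copy_SES[OF \<tau>] assms(2-5) C in simp_all)
  ultimately show ?thesis
    by (simp add: interaccessible_def)
qed

end

section \<open>Equal changes of entropy\<close>

text \<open>
  The entropy change from \<open>b1\<close> to \<open>b2\<close> equals that from \<open>c1\<close> to \<open>c2\<close>. Since the two systems need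
  not be disjoint (they may be the same), \<open>c1\<close> and \<open>c2\<close> are moved to a copy; allowing only copies
  that avoid finitely many given systems makes it unnecessary to compare different copies.
\<close>

definition equal_entropy_change :: "('p, 's, 'r, 'z) world_scheme \<Rightarrow> 's \<Rightarrow> 's \<Rightarrow> 's \<Rightarrow> 's \<Rightarrow> bool" where
  "equal_entropy_change W b1 b2 c1 c2 \<longleftrightarrow>
     SES W b1 \<and> SES W b2 \<and> SES W c1 \<and> SES W c2 \<and> same_regions W b1 b2 \<and> same_regions W c1 c2 \<and>
     (\<exists>\<B>. finite \<B> \<and> \<B> \<subseteq> systems W \<and>
       (\<forall>C' \<sigma>. identical_copy W (constituents W c1) C' \<sigma> \<and> C' \<inter> \<Union>\<B> = {}
         \<longrightarrow> interaccessible W (b1 \<bowtie>\<^bsub>W\<^esub> \<sigma> c2) (b2 \<bowtie>\<^bsub>W\<^esub> \<sigma> c1)))"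

lemma equal_entropy_change_SES:
  assumes "equal_entropy_change W b1 b2 c1 c2"
  shows "SES W b1" "SES W b2" "SES W c1" "SES W c2" "same_regions W b1 b2" "same_regions W c1 c2"
    "constituents W b2 = constituents W b1" "constituents W c2 = constituents W c1"
  using assms by (simp_all add: equal_entropy_change_def same_regions_def)

section \<open>Calculus of equal entropy changes\<close>

context thermodynamics
begin

text \<open>The family to be avoided is enlarged by the system of \<open>b1\<close>, so that every
  admissible copy can be composed with \<open>b1\<close>.\<close>

lemma equal_entropy_changeE:
  assumes "equal_entropy_change W b1 b2 c1 c2"
  obtains \<B> where "finite \<B>" "\<B> \<subseteq> systems W" "constituents W b1 \<in> \<B>"
    "\<And>C' \<sigma>. \<lbrakk>identical_copy W (constituents W c1) C' \<sigma>; C' \<inter> \<Union>\<B> = {}\<rbrakk>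
        \<Longrightarrow> interaccessible W (b1 \<bowtie> \<sigma> c2) (b2 \<bowtie> \<sigma> c1)"
proof -
  have "\<exists>\<B>. finite \<B> \<and> \<B> \<subseteq> systems W \<and>
       (\<forall>C' \<sigma>. identical_copy W (constituents W c1) C' \<sigma> \<and> C' \<inter> \<Union>\<B> = {}
         \<longrightarrow> interaccessible W (b1 \<bowtie> \<sigma> c2) (b2 \<bowtie> \<sigma> c1))"
    using assms by (simp only: equal_entropy_change_def)
  then obtain \<B> where "finite \<B> \<and> \<B> \<subseteq> systems W \<and>
       (\<forall>C' \<sigma>. identical_copy W (constituents W c1) C' \<sigma> \<and> C' \<inter> \<Union>\<B> = {}
         \<longrightarrow> interaccessible W (b1 \<bowtie> \<sigma> c2) (b2 \<bowtie> \<sigma> c1))" ..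
  then have \<B>: "finite \<B>" "\<B> \<subseteq> systems W"
    "\<And>C' \<sigma>. \<lbrakk>identical_copy W (constituents W c1) C' \<sigma>; C' \<inter> \<Union>\<B> = {}\<rbrakk>
        \<Longrightarrow> interaccessible W (b1 \<bowtie> \<sigma> c2) (b2 \<bowtie> \<sigma> c1)"
    by simp_all
  show ?thesis
  proof (rule that[of "insert (constituents W b1) \<B>"])
    show "insert (constituents W b1) \<B> \<subseteq> systems W"
      using \<B>(2) SES_systems[OF equal_entropy_change_SES(1)[OF assms]] by simp
    show "interaccessible W (b1 \<bowtie> \<sigma> c2) (b2 \<bowtie> \<sigma> c1)"
      if "identical_copy W (constituents W c1) C' \<sigma>" "C' \<inter> \<Union>(insert (constituents W b1) \<B>) = {}" for C' \<sigma>
      using \<B>(3)[OF that(1)] that(2) by auto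
  qed (simp_all add: \<B>)
qed

lemma equal_entropy_changeI:
  assumes "SES W b1" "SES W b2" "SES W c1" "SES W c2" "same_regions W b1 b2" "same_regions W c1 c2"
    and \<B>: "finite \<B>" "\<B> \<subseteq> systems W"
    and "\<And>C' \<sigma>. \<lbrakk>identical_copy W (constituents W c1) C' \<sigma>; C' \<inter> \<Union>\<B> = {};
      constituents W (\<sigma> c1) = C'; constituents W (\<sigma> c2) = C'; SES W (\<sigma> c1); SES W (\<sigma> c2)\<rbrakk>
        \<Longrightarrow> interaccessible W (b1 \<bowtie> \<sigma> c2) (b2 \<bowtie> \<sigma> c1)"
  shows "equal_entropy_change W b1 b2 c1 c2"
proof -
  have *: "interaccessible W (b1 \<bowtie> \<sigma> c2) (b2 \<bowtie> \<sigma> c1)"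
    if \<sigma>: "identical_copy W (constituents W c1) C' \<sigma>" "C' \<inter> \<Union>\<B> = {}" for C' \<sigma>
  proof (rule assms(9)[OF \<sigma>])
    have "constituents W c2 = constituents W c1" using assms(6) by (simp add: same_regions_def)
    then show "constituents W (\<sigma> c2) = C'" by (rule copy_constituents[OF \<sigma>(1)])
    show "constituents W (\<sigma> c1) = C'" by (rule copy_constituents[OF \<sigma>(1) refl])
  qed (rule copy_SES[OF \<sigma>(1)], fact)+
  show ?thesis
    unfolding equal_entropy_change_def
    by (intro conjI exI[of _ \<B>] allI impI assms(1-8)) (elim conjE, rule *)
qed

lemma fresh_copy:
  assumes "SES W c" "finite \<B>" "\<B> \<subseteq> systems W"
  obtains C' \<sigma> where "identical_copy W (constituents W c) C' \<sigma>" "C' \<inter> \<Union>\<B> = {}" "C' \<in> systems W"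
    "constituents W c \<inter> C' = {}"
proof -
  obtain C' \<sigma> where *: "identical_copy W (constituents W c) C' \<sigma>" "C' \<inter> \<Union>\<B> = {}"
    using copies_exist[OF SES_systems[OF assms(1)] assms(2,3)] by blast
  show ?thesis
    by (rule that[OF *]) (simp_all add: copy_systems[OF *(1)] SES_systems[OF assms(1)] copy_disjoint[OF *(1)])
qed

lemma equal_entropy_change_sym:
  assumes "equal_entropy_change W b1 b2 c1 c2"
  shows "equal_entropy_change W b2 b1 c2 c1"
proof -
  note s = equal_entropy_change_SES[OF assms]
  obtain \<B> where \<B>: "finite \<B>" "\<B> \<subseteq> systems W"
    "\<And>C' \<sigma>. \<lbrakk>identical_copy W (constituents W c1) C' \<sigma>; C' \<inter> \<Union>\<B> = {}\<rbrakk>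
        \<Longrightarrow> interaccessible W (b1 \<bowtie> \<sigma> c2) (b2 \<bowtie> \<sigma> c1)"
    using equal_entropy_changeE[OF assms] by metis
  show ?thesis
    by (rule equal_entropy_changeI[OF s(2,1,4,3) same_regions_sym[OF s(5)] same_regions_sym[OF s(6)] \<B>(1,2)])
      (use interaccessible_sym[OF \<B>(3)] s in simp)
qed

lemma equal_entropy_change_refl:
  assumes "SES W b" "SES W c"
  shows "equal_entropy_change W b b c c"
proof (rule equal_entropy_changeI[where \<B> = "{constituents W b}"])
  fix C' \<sigma>
  assume \<sigma>: "C' \<inter> \<Union>{constituents W b} = {}" "constituents W (\<sigma> c) = C'" "SES W (\<sigma> c)"
  show "interaccessible W (b \<bowtie> \<sigma> c) (b \<bowtie> \<sigma> c)"
    by (rule interaccessible_idle)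
      (use \<sigma> assms SES_systems SES_interaccessible_refl in \<open>auto simp: apart_def\<close>)
qed (use assms SES_systems in \<open>simp_all add: same_regions_def\<close>)

text \<open>Go from \<open>b1\<close>, \<open>c2\<close> to \<open>b2\<close>, \<open>c1\<close>,
  raise \<open>b2\<close> to \<open>b3\<close>, and go on to \<open>b1\<close>, \<open>c3\<close>.
  The first system has returned, so \<open>c3\<close> is accessible from \<open>c2\<close>, and the
  second law orders their energies. This is what makes the functions f single-valued and
  monotone.\<close>

lemma equal_entropy_change_mono:
  assumes M: "equal_entropy_change W b1 b2 c1 c2" and M': "equal_entropy_change W b1 b3 c1 c3"
    and "E b2 \<le> E b3"
  shows "E c2 \<le> E c3"
proof -
  note s = equal_entropy_change_SES[OF M] note s' = equal_entropy_change_SES[OF M']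
  obtain \<B> where \<B>: "finite \<B>" "\<B> \<subseteq> systems W" "constituents W b1 \<in> \<B>"
    "\<And>C' \<sigma>. \<lbrakk>identical_copy W (constituents W c1) C' \<sigma>; C' \<inter> \<Union>\<B> = {}\<rbrakk>
        \<Longrightarrow> interaccessible W (b1 \<bowtie> \<sigma> c2) (b2 \<bowtie> \<sigma> c1)"
    using equal_entropy_changeE[OF M] by metis
  obtain \<B>' where \<B>': "finite \<B>'" "\<B>' \<subseteq> systems W" "constituents W b1 \<in> \<B>'"
    "\<And>C' \<sigma>. \<lbrakk>identical_copy W (constituents W c1) C' \<sigma>; C' \<inter> \<Union>\<B>' = {}\<rbrakk>
        \<Longrightarrow> interaccessible W (b1 \<bowtie> \<sigma> c3) (b3 \<bowtie> \<sigma> c1)"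
    using equal_entropy_changeE[OF M'] by metis
  have f: "finite (\<B> \<union> \<B>')" "\<B> \<union> \<B>' \<subseteq> systems W" using \<B>(1,2) \<B>'(1,2) by simp_all
  obtain C' \<sigma> where \<sigma>: "identical_copy W (constituents W c1) C' \<sigma>" "C' \<inter> \<Union>(\<B> \<union> \<B>') = {}" "C' \<in> systems W"
      "constituents W c1 \<inter> C' = {}"
    by (rule fresh_copy[OF s(3) f])
  have C: "constituents W (\<sigma> c1) = C'" "constituents W (\<sigma> c2) = C'" "constituents W (\<sigma> c3) = C'"
    using copy_constituents[OF \<sigma>(1)] s s' by simp_all
  have BC: "constituents W b1 \<inter> C' = {}" using \<sigma>(2) \<B>(3) by auto
  have ap: "apart W b1 (\<sigma> c2)" "apart W b2 (\<sigma> c1)"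
    using BC C s by (simp_all add: apart_def)
  have sy: "constituents W (b1 \<bowtie> \<sigma> c2) \<in> systems W"
    by (rule compose_systems) (use ap s SES_systems C \<sigma> in simp_all)
  have 1: "accessible W (b1 \<bowtie> \<sigma> c2) (b2 \<bowtie> \<sigma> c1)"
    using \<B>(4)[OF \<sigma>(1)] \<sigma>(2) by (auto simp: interaccessible_def)
  have 2: "accessible W (b2 \<bowtie> \<sigma> c1) (b3 \<bowtie> \<sigma> c1)"
  proof (rule accessible_idle)
    have "same_regions W b2 b3" using s s' by (simp add: same_regions_def)
    then show "accessible W b2 b3" using SES_accessible s s' assms(3) by simp
  qed (use ap s SES_systems copy_SES[OF \<sigma>(1)] in simp_all)
  have 3: "accessible W (b3 \<bowtie> \<sigma> c1) (b1 \<bowtie> \<sigma> c3)"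
    using \<B>'(4)[OF \<sigma>(1)] \<sigma>(2) by (auto simp: interaccessible_def)
  have "accessible W (b1 \<bowtie> \<sigma> c2) (b1 \<bowtie> \<sigma> c3)"
    using accessible_trans[OF sy accessible_trans[OF sy 1 2] 3] .
  moreover have "b1 \<bowtie> \<sigma> c2 = \<sigma> c2 \<bowtie> b1" "b1 \<bowtie> \<sigma> c3 = \<sigma> c3 \<bowtie> b1"
    using BC C by (auto intro!: compose_commute simp: apart_def)
  ultimately have "accessible W (\<sigma> c2) (\<sigma> c3)"
    using accessible_drop[of "\<sigma> c2" b1 "\<sigma> c3"] ap apart_sym C by simp
  then have "accessible W c2 c3" using copy_accessible[OF \<sigma>(1)] by simp
  moreover have "same_regions W c2 c3" using s s' by (simp add: same_regions_def)
  ultimately show ?thesis using SES_accessible_energy_le s by simp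
qed

lemma equal_entropy_change_unique:
  assumes "equal_entropy_change W b1 b2 c1 c2" "equal_entropy_change W b1 b2 c1 c3"
  shows "c2 = c3"
proof -
  note s = equal_entropy_change_SES[OF assms(1)] note s' = equal_entropy_change_SES[OF assms(2)]
  have "E c2 = E c3"
    using equal_entropy_change_mono[OF assms] equal_entropy_change_mono[OF assms(2,1)] by simp
  moreover have "same_regions W c2 c3" using s s' by (simp add: same_regions_def)
  ultimately show ?thesis using SES_unique s s' by simp
qed

text \<open>The auxiliary system X in \<open>f_graph\<close> serves as the catalyst of
  \<open>interaccessible_via\<close>. Copies have to avoid it, so that moving \<open>c1\<close> and
  \<open>c2\<close> to a copy leaves \<open>x1\<close> and \<open>x2\<close> fixed.\<close>

lemma f_graph_equal_entropy_change:
  assumes "(e, e') \<in> f_graph W E b1 c1" "SES W b1" "SES W c1"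
  obtains b2 c2 where "equal_entropy_change W b1 b2 c1 c2" "E b2 = e" "E c2 = e'"
proof -
  obtain b2 c2 x1 x2 where x: "constituents W x1 \<in> systems W" "apart W x1 b1" "apart W x1 c1"
    "standard_reversible W x1 b1 x2 b2" "standard_reversible W x1 c1 x2 c2"
    and e: "E b2 = e" "E c2 = e'"
    using assms(1) unfolding f_graph_def by blast
  have b: "SES W b2" "same_regions W b1 b2" "constituents W x2 = constituents W x1"
     "interaccessible W (x1 \<bowtie> b1) (x2 \<bowtie> b2)"
    using x(4) reversible_interaccessible by (auto simp: standard_reversible_def)
  have c: "SES W c2" "same_regions W c1 c2"
     "interaccessible W (x1 \<bowtie> c1) (x2 \<bowtie> c2)"
    using x(5) reversible_interaccessible by (auto simp: standard_reversible_def)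
  have "equal_entropy_change W b1 b2 c1 c2"
  proof (rule equal_entropy_changeI[where \<B> = "{constituents W x1, constituents W b1}"])
    fix C' \<sigma>
    assume \<sigma>: "identical_copy W (constituents W c1) C' \<sigma>" "C' \<inter> \<Union>{constituents W x1, constituents W b1} = {}"
      "constituents W (\<sigma> c1) = C'" "constituents W (\<sigma> c2) = C'" "SES W (\<sigma> c1)" "SES W (\<sigma> c2)"
    then have dis: "constituents W x1 \<inter> C' = {}" "constituents W b1 \<inter> C' = {}" by auto
    have "\<sigma> x1 = x1" "\<sigma> x2 = x2"
      using copy_fixes[OF \<sigma>(1), of x1] copy_fixes[OF \<sigma>(1), of x2] b(3) x(3) dis(1)
      by (simp_all add: apart_def)
    moreover have "interaccessible W (\<sigma> (x1 \<bowtie> c1)) (\<sigma> (x2 \<bowtie> c2))"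
      using copy_interaccessible[OF \<sigma>(1)] c(3) by simp
    moreover have "apart W x2 c2" using x(3) b(3) c(2) by (simp add: apart_def same_regions_def)
    ultimately have "interaccessible W (x1 \<bowtie> \<sigma> c1) (x2 \<bowtie> \<sigma> c2)"
      using copy_compose[OF \<sigma>(1)] x(3) by simp
    then show "interaccessible W (b1 \<bowtie> \<sigma> c2) (b2 \<bowtie> \<sigma> c1)"
      by (rule interaccessible_via[OF b(4)])
        (use x b c \<sigma> dis in \<open>simp_all add: apart_def same_regions_def\<close>)
  qed (use assms b c x SES_systems in simp_all)
  then show ?thesis using that e by blast
qed

text \<open>Composition of the functions \<open>f\<close>; the copy of the middle system serves as the catalyst.\<close>

lemma equal_entropy_change_trans:
  assumes M: "equal_entropy_change W d1 d2 b1 b2" and M': "equal_entropy_change W b1 b2 c1 c2"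
  shows "equal_entropy_change W d1 d2 c1 c2"
proof -
  note s = equal_entropy_change_SES[OF M] note s' = equal_entropy_change_SES[OF M']
  obtain \<B> where \<B>: "finite \<B>" "\<B> \<subseteq> systems W" "constituents W d1 \<in> \<B>"
    "\<And>C' \<sigma>. \<lbrakk>identical_copy W (constituents W b1) C' \<sigma>; C' \<inter> \<Union>\<B> = {}\<rbrakk>
        \<Longrightarrow> interaccessible W (d1 \<bowtie> \<sigma> b2) (d2 \<bowtie> \<sigma> b1)"
    using equal_entropy_changeE[OF M] by metis
  obtain \<B>' where \<B>': "finite \<B>'" "\<B>' \<subseteq> systems W" "constituents W b1 \<in> \<B>'"
    "\<And>C' \<sigma>. \<lbrakk>identical_copy W (constituents W c1) C' \<sigma>; C' \<inter> \<Union>\<B>' = {}\<rbrakk>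
        \<Longrightarrow> interaccessible W (b1 \<bowtie> \<sigma> c2) (b2 \<bowtie> \<sigma> c1)"
    using equal_entropy_changeE[OF M'] by metis
  show ?thesis
  proof (rule equal_entropy_changeI[where \<B> = "\<B> \<union> \<B>'"])
    fix C' \<sigma>
    assume \<sigma>: "identical_copy W (constituents W c1) C' \<sigma>" "C' \<inter> \<Union>(\<B> \<union> \<B>') = {}"
      "constituents W (\<sigma> c1) = C'" "constituents W (\<sigma> c2) = C'" "SES W (\<sigma> c1)" "SES W (\<sigma> c2)"
    then have C': "C' \<in> systems W" using SES_systems by blast
    have dis: "constituents W d1 \<inter> C' = {}" "constituents W b1 \<inter> C' = {}"
      using \<sigma>(2) \<B>(3) \<B>'(3) by auto
    \<comment> \<open>The copy of the middle system must also avoid \<open>C'\<close>, which already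
      carries the states of the third system.\<close>
    have f: "finite (\<B> \<union> {C'})" "\<B> \<union> {C'} \<subseteq> systems W" using \<B>(1,2) C' by simp_all
    obtain B' \<tau> where \<tau>: "identical_copy W (constituents W b1) B' \<tau>" "B' \<inter> \<Union>(\<B> \<union> {C'}) = {}" "B' \<in> systems W"
      "constituents W b1 \<inter> B' = {}"
      by (rule fresh_copy[OF s(3) f])
    have dis': "constituents W d1 \<inter> B' = {}" "C' \<inter> B' = {}"
      using \<tau>(2) \<B>(3) by auto
    have B: "constituents W (\<tau> b1) = B'" "constituents W (\<tau> b2) = B'"
      using copy_constituents[OF \<tau>(1)] s by simp_all
    \<comment> \<open>Exchanging the middle system with its copy while \<open>\<sigma> c1\<close>
      and \<open>\<sigma> c2\<close> stay fixed transports the second relation to the copy that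
      occurs in the first.\<close>
    have "\<tau> (\<sigma> c1) = \<sigma> c1" "\<tau> (\<sigma> c2) = \<sigma> c2"
      using copy_fixes[OF \<tau>(1)] \<sigma>(3,4) dis(2) dis'(2) by (simp_all add: Int_commute)
    moreover have "C' \<inter> \<Union>\<B>' = {}" using \<sigma>(2) by auto
    then have "interaccessible W (\<tau> (b1 \<bowtie> \<sigma> c2)) (\<tau> (b2 \<bowtie> \<sigma> c1))"
      using copy_interaccessible[OF \<tau>(1)] \<B>'(4)[OF \<sigma>(1)] by simp
    moreover have "apart W b1 (\<sigma> c2)" "apart W b2 (\<sigma> c1)"
      using dis \<sigma> s by (simp_all add: apart_def)
    ultimately have 1: "interaccessible W (\<tau> b2 \<bowtie> \<sigma> c1) (\<tau> b1 \<bowtie> \<sigma> c2)"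
      using copy_compose[OF \<tau>(1)] interaccessible_sym by simp
    have "interaccessible W (d1 \<bowtie> \<tau> b2) (d2 \<bowtie> \<tau> b1)"
      using \<B>(4)[OF \<tau>(1)] \<tau>(2) by auto
    then have 2: "interaccessible W (\<tau> b2 \<bowtie> d1) (\<tau> b1 \<bowtie> d2)"
      using compose_commute[of d1 "\<tau> b2"] compose_commute[of d2 "\<tau> b1"] dis' B s(7)
      by (simp add: apart_def)
    show "interaccessible W (d1 \<bowtie> \<sigma> c2) (d2 \<bowtie> \<sigma> c1)"
      by (rule interaccessible_via[OF 2 1])
        (use dis dis' B \<sigma> s \<tau> in \<open>simp_all add: apart_def Int_commute\<close>)
  qed (use s s' \<B> \<B>' in simp_all)
qed

text \<open>Consecutive changes are joined by means of a second copy, \<open>\<tau>\<close>, and an exchange of copies.\<close>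

lemma equal_entropy_change_join:
  assumes M: "equal_entropy_change W b1 b2 c1 c2" and M': "equal_entropy_change W b2 b3 c2 c3"
  shows "equal_entropy_change W b1 b3 c1 c3"
proof -
  note s = equal_entropy_change_SES[OF M] note s' = equal_entropy_change_SES[OF M']
  have eq: "constituents W b3 = constituents W b1" "constituents W c3 = constituents W c1"
    using s s' by simp_all
  obtain \<B> where \<B>: "finite \<B>" "\<B> \<subseteq> systems W" "constituents W b1 \<in> \<B>"
    "\<And>C' \<sigma>. \<lbrakk>identical_copy W (constituents W c1) C' \<sigma>; C' \<inter> \<Union>\<B> = {}\<rbrakk>
        \<Longrightarrow> interaccessible W (b1 \<bowtie> \<sigma> c2) (b2 \<bowtie> \<sigma> c1)"
    using equal_entropy_changeE[OF M] by metis
  obtain \<B>' where \<B>': "finite \<B>'" "\<B>' \<subseteq> systems W"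
    "\<And>C' \<sigma>. \<lbrakk>identical_copy W (constituents W c2) C' \<sigma>; C' \<inter> \<Union>\<B>' = {}\<rbrakk>
        \<Longrightarrow> interaccessible W (b2 \<bowtie> \<sigma> c3) (b3 \<bowtie> \<sigma> c2)"
    using equal_entropy_changeE[OF M'] by metis
  show ?thesis
  proof (rule equal_entropy_changeI[where \<B> = "\<B> \<union> \<B>'"])
    fix C' \<sigma>
    assume \<sigma>: "identical_copy W (constituents W c1) C' \<sigma>" "C' \<inter> \<Union>(\<B> \<union> \<B>') = {}"
      "constituents W (\<sigma> c1) = C'" "constituents W (\<sigma> c3) = C'" "SES W (\<sigma> c1)" "SES W (\<sigma> c3)"
    have \<sigma>2: "constituents W (\<sigma> c2) = C'" "SES W (\<sigma> c2)"
      using copy_constituents[OF \<sigma>(1)] copy_SES[OF \<sigma>(1)] s by simp_all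
    have C': "C' \<in> systems W" using SES_systems \<sigma>(3,5) by blast
    have f: "finite (\<B> \<union> {C'})" "\<B> \<union> {C'} \<subseteq> systems W" using \<B>(1,2) C' by simp_all
    obtain C'' \<tau> where \<tau>: "identical_copy W (constituents W c1) C'' \<tau>" "C'' \<inter> \<Union>(\<B> \<union> {C'}) = {}" "C'' \<in> systems W"
      "constituents W c1 \<inter> C'' = {}"
      by (rule fresh_copy[OF s(3) f])
    have t: "constituents W (\<tau> c1) = C''" "constituents W (\<tau> c2) = C''" "SES W (\<tau> c1)" "SES W (\<tau> c2)"
      using copy_constituents[OF \<tau>(1)] copy_SES[OF \<tau>(1)] s by simp_all
    have dis: "constituents W b1 \<inter> C' = {}" "constituents W b1 \<inter> C'' = {}" "C' \<inter> C'' = {}"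
      using \<sigma>(2) \<tau>(2) \<B>(3) by auto
    have "\<sigma> (\<tau> c1) = \<tau> c1" "\<sigma> (\<tau> c2) = \<tau> c2"
      using copy_fixes[OF \<sigma>(1)] t dis(3) \<tau>(4) by (simp_all add: Int_commute)
    moreover have "interaccessible W (\<sigma> (c2 \<bowtie> \<tau> c1)) (\<sigma> (c1 \<bowtie> \<tau> c2))"
      using copy_interaccessible[OF \<sigma>(1)] copy_swap[OF \<tau>(1)] s by simp
    moreover have "apart W c1 (\<tau> c2)" "apart W c2 (\<tau> c1)"
      using \<tau>(4) t s by (simp_all add: apart_def)
    ultimately have h3: "interaccessible W (\<sigma> c2 \<bowtie> \<tau> c1) (\<sigma> c1 \<bowtie> \<tau> c2)"
      using copy_compose[OF \<sigma>(1)] by simp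
    have h1: "interaccessible W (b1 \<bowtie> \<tau> c2) (b2 \<bowtie> \<tau> c1)"
      using \<B>(4)[OF \<tau>(1)] \<tau>(2) by auto
    have "C' \<inter> \<Union>\<B>' = {}" using \<sigma>(2) by auto
    then have h2: "interaccessible W (b2 \<bowtie> \<sigma> c3) (b3 \<bowtie> \<sigma> c2)"
      using \<B>'(3) s(8) \<sigma>(1) by simp
    have sy: "constituents W b1 \<in> systems W" using s SES_systems by blast
    have ap: "apart W b1 (\<tau> c2)" "apart W b1 (\<sigma> c3)" "apart W b2 (\<tau> c1)" "apart W b2 (\<sigma> c3)"
      "apart W b3 (\<sigma> c1)" "apart W b3 (\<sigma> c2)" "apart W b3 (\<tau> c1)" "apart W b3 (\<tau> c2)"
      "apart W (\<sigma> c2) b3" "apart W (\<tau> c1) b3"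
      "apart W (\<sigma> c3) (\<tau> c1)" "apart W (\<sigma> c3) (\<tau> c2)" "apart W (\<sigma> c2) (\<tau> c1)" "apart W (\<sigma> c1) (\<tau> c2)"
      "apart W (\<tau> c1) (\<sigma> c3)" "apart W (\<tau> c2) (\<sigma> c3)"
      using dis \<sigma>(3,4) \<sigma>2 t s(7) eq by (simp_all add: apart_def Int_commute)
    \<comment> \<open>Start with \<open>b1\<close>, \<open>\<sigma> c3\<close>,
      \<open>\<tau> c2\<close>. The copy \<open>\<tau>\<close> drives \<open>b1\<close> to
      \<open>b2\<close>, the copy \<open>\<sigma>\<close> drives \<open>b2\<close> to
      \<open>b3\<close>, and the exchange of the two copies restores \<open>\<tau> c2\<close> and
      leaves \<open>\<sigma> c1\<close>.\<close>
    have 1: "interaccessible W ((b1 \<bowtie> \<tau> c2) \<bowtie> \<sigma> c3) ((b2 \<bowtie> \<tau> c1) \<bowtie> \<sigma> c3)"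
      by (rule interaccessible_idle[OF _ _ _ h1]) (use ap sy t \<sigma> \<tau> in \<open>simp_all add: compose_systems\<close>)
    have 2: "interaccessible W ((b2 \<bowtie> \<sigma> c3) \<bowtie> \<tau> c1) ((b3 \<bowtie> \<sigma> c2) \<bowtie> \<tau> c1)"
      by (rule interaccessible_idle[OF _ _ _ h2]) (use ap sy t \<sigma> \<tau> s C' in \<open>simp_all add: compose_systems\<close>)
    have 3: "interaccessible W (b3 \<bowtie> (\<sigma> c2 \<bowtie> \<tau> c1)) (b3 \<bowtie> (\<sigma> c1 \<bowtie> \<tau> c2))"
      by (rule interaccessible_idle'[OF _ _ _ h3]) (use ap sy t \<sigma>2 \<tau> s s' C' in \<open>simp_all add: compose_systems\<close>)
    have r: "(b1 \<bowtie> \<tau> c2) \<bowtie> \<sigma> c3 = (b1 \<bowtie> \<sigma> c3) \<bowtie> \<tau> c2" "(b2 \<bowtie> \<tau> c1) \<bowtie> \<sigma> c3 = (b2 \<bowtie> \<sigma> c3) \<bowtie> \<tau> c1"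
       "b3 \<bowtie> (\<sigma> c2 \<bowtie> \<tau> c1) = (b3 \<bowtie> \<sigma> c2) \<bowtie> \<tau> c1" "b3 \<bowtie> (\<sigma> c1 \<bowtie> \<tau> c2) = (b3 \<bowtie> \<sigma> c1) \<bowtie> \<tau> c2"
      using ap compose_commute[of "\<tau> c2" "\<sigma> c3"] compose_commute[of "\<tau> c1" "\<sigma> c3"]
      by (simp_all add: compose_assoc)
    have sy1: "constituents W ((b1 \<bowtie> \<sigma> c3) \<bowtie> \<tau> c2) \<in> systems W"
      using ap sy t \<sigma> \<tau> C' by (simp add: compose_systems)
    have "interaccessible W ((b1 \<bowtie> \<sigma> c3) \<bowtie> \<tau> c2) ((b3 \<bowtie> \<sigma> c1) \<bowtie> \<tau> c2)"
      using interaccessible_trans[OF sy1 interaccessible_trans[OF sy1 1[unfolded r] 2] 3[unfolded r]] .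
    then show "interaccessible W (b1 \<bowtie> \<sigma> c3) (b3 \<bowtie> \<sigma> c1)"
      by (rule interaccessible_drop) (use ap \<sigma> eq in \<open>simp_all add: constituents_compose\<close>)
  qed (use s s' \<B> \<B>' in \<open>auto simp: same_regions_def\<close>)
qed

text \<open>Interaccessible states can replace one another inside the copy while the first system is
  idle. It is applied to equivalent stable equilibrium states, which occupy different
  regions.\<close>

lemma equal_entropy_change_cong:
  assumes M: "equal_entropy_change W d1 d2 b b'" and "interaccessible W b a" "interaccessible W b' a'"
    and a: "SES W a" "SES W a'" "same_regions W a a'"
  shows "equal_entropy_change W d1 d2 a a'"
proof -
  note s = equal_entropy_change_SES[OF M]
  have eq: "constituents W a = constituents W b" "constituents W a' = constituents W b"
    using interaccessible_constituents assms(2,3) s by metis+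
  obtain \<B> where \<B>: "finite \<B>" "\<B> \<subseteq> systems W" "constituents W d1 \<in> \<B>"
    "\<And>C' \<sigma>. \<lbrakk>identical_copy W (constituents W b) C' \<sigma>; C' \<inter> \<Union>\<B> = {}\<rbrakk>
        \<Longrightarrow> interaccessible W (d1 \<bowtie> \<sigma> b') (d2 \<bowtie> \<sigma> b)"
    using equal_entropy_changeE[OF M] by metis
  show ?thesis
  proof (rule equal_entropy_changeI[where \<B> = "\<B>"])
    fix C' \<sigma>
    assume \<sigma>: "identical_copy W (constituents W a) C' \<sigma>" "C' \<inter> \<Union>\<B> = {}"
      "constituents W (\<sigma> a) = C'" "constituents W (\<sigma> a') = C'" "SES W (\<sigma> a)" "SES W (\<sigma> a')"
    have \<sigma>b: "constituents W (\<sigma> b) = C'" "constituents W (\<sigma> b') = C'"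
      using copy_constituents[OF \<sigma>(1)] eq s by simp_all
    have C': "C' \<in> systems W" using SES_systems \<sigma>(3,5) by blast
    have dis: "constituents W d1 \<inter> C' = {}" using \<sigma>(2) \<B>(3) by auto
    have 1: "interaccessible W (d1 \<bowtie> \<sigma> a') (d1 \<bowtie> \<sigma> b')"
      by (rule interaccessible_idle')
        (use copy_interaccessible[OF \<sigma>(1)] assms(3) interaccessible_sym s \<sigma> dis C' in \<open>simp_all add: apart_def Int_commute\<close>)
    have 2: "interaccessible W (d1 \<bowtie> \<sigma> b') (d2 \<bowtie> \<sigma> b)"
      using \<B>(4) \<sigma>(1,2) eq by simp
    have 3: "interaccessible W (d2 \<bowtie> \<sigma> b) (d2 \<bowtie> \<sigma> a)"
      by (rule interaccessible_idle')
        (use copy_interaccessible[OF \<sigma>(1)] assms(2) s \<sigma>b dis C' in \<open>simp_all add: apart_def Int_commute\<close>)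
    have sy: "constituents W (d1 \<bowtie> \<sigma> a') \<in> systems W"
      by (rule compose_systems) (use s SES_systems \<sigma> C' dis in \<open>simp_all add: apart_def\<close>)
    show "interaccessible W (d1 \<bowtie> \<sigma> a') (d2 \<bowtie> \<sigma> a)"
      using interaccessible_trans[OF sy interaccessible_trans[OF sy 1 2] 3] .
  qed (use s a \<B> in simp_all)
qed

end

section \<open>Temperature\<close>

text \<open>A right-hand interval is all that \<open>f_defined\<close> guarantees when a state of
  lowest energy is involved.\<close>

lemma real_derivative_within_unique:
  fixes f :: "real \<Rightarrow> real"
  assumes "(f has_real_derivative D) (at x within S)" "(f has_real_derivative D') (at x within S)"
    and "{x..<x + \<epsilon>} \<subseteq> S" "\<epsilon> > 0"
  shows "D = D'"
proof -
  have "at x within {x..<x + \<epsilon>} \<noteq> bot"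
    using assms(4) by (simp add: trivial_limit_within islimpt_Ico)
  then have "at x within S \<noteq> bot"
    using assms(3) at_le[of "{x..<x + \<epsilon>}" S x] by (metis bot.extremum_uniqueI)
  then show ?thesis
    using assms(1,2) tendsto_unique unfolding has_field_derivative_iff by blast
qed

section \<open>The functions f, their derivatives and the temperature\<close>

context thermodynamics
begin

abbreviation "temp \<equiv> temperature W E r1 T1"

lemma SES_raise:
  assumes "SES W a" "E a \<le> e"
  obtains b where "SES W b" "same_regions W a b" "E b = e"
proof (cases "E a = e")
  case True
  then show ?thesis using that assms(1) by (simp add: same_regions_def)
next
  case False
  then obtain c where c: "same_regions W a c" "E c = e"
    using raise_energy[OF SES_systems[OF assms(1)]] assms(2) by (metis less_eq_real_def)
  then have "constituents W c \<in> systems W" using SES_systems[OF assms(1)] by (simp add: same_regions_def)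
  then obtain b where "SES W b" "same_regions W c b" "E b = E c"
    using SES_exists by blast
  then show ?thesis using that[of b] c same_regions_trans by metis
qed

lemma f_domE:
  assumes "e \<in> f_dom W E b c" "SES W b" "SES W c"
  obtains b2 c2 where "equal_entropy_change W b b2 c c2" "E b2 = e" "E c2 = f_fun W E b c e"
proof -
  obtain e' where e': "(e, e') \<in> f_graph W E b c" using assms(1) by auto
  then obtain b2 c2 where M: "equal_entropy_change W b b2 c c2" and e: "E b2 = e" "E c2 = e'"
    using f_graph_equal_entropy_change assms(2,3) by metis
  \<comment> \<open>Uniqueness of the value follows from monotonicity applied in both
    directions.\<close>
  have *: "e'' = e'" if e'': "(e, e'') \<in> f_graph W E b c" for e''
  proof -
    obtain b3 c3 where M': "equal_entropy_change W b b3 c c3" and e3: "E b3 = e" "E c3 = e''"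
      using f_graph_equal_entropy_change e'' assms(2,3) by metis
    show ?thesis
      using equal_entropy_change_mono[OF M M'] equal_entropy_change_mono[OF M' M] e e3 by simp
  qed
  have "f_fun W E b c e = e'"
    unfolding f_fun_def using e' * by (rule the_equality)
  then show ?thesis using that[OF M] e by simp
qed

lemma f_fun_eq:
  assumes M: "equal_entropy_change W b b2 c c2" and e: "E b2 \<in> f_dom W E b c"
  shows "f_fun W E b c (E b2) = E c2"
proof -
  note s = equal_entropy_change_SES[OF M]
  obtain b3 c3 where M': "equal_entropy_change W b b3 c c3" and "E b3 = E b2" "E c3 = f_fun W E b c (E b2)"
    using f_domE[OF e s(1,3)] by metis
  then show ?thesis
    using equal_entropy_change_mono[OF M M'] equal_entropy_change_mono[OF M' M] by simp
qed

lemma f_fun_mono: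
  assumes "SES W b" "SES W c" "e \<in> f_dom W E b c" "e' \<in> f_dom W E b c" "e \<le> e'"
  shows "f_fun W E b c e \<le> f_fun W E b c e'"
proof -
  obtain b2 c2 where M: "equal_entropy_change W b b2 c c2" "E b2 = e" "E c2 = f_fun W E b c e"
    by (rule f_domE[OF assms(3,1,2)])
  obtain b3 c3 where M': "equal_entropy_change W b b3 c c3" "E b3 = e'" "E c3 = f_fun W E b c e'"
    by (rule f_domE[OF assms(4,1,2)])
  show ?thesis
    using equal_entropy_change_mono[OF M(1) M'(1)] M M' assms(5) by simp
qed

lemma f_dom_right:
  assumes "SES W b" "SES W c"
  obtains \<epsilon> where "\<epsilon> > 0" "{E b ..< E b + \<epsilon>} \<subseteq> f_dom W E b c"
  using f_defined[OF assms] by metis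

lemma f_fun_base:
  assumes "SES W b" "SES W c"
  shows "f_fun W E b c (E b) = E c"
proof -
  have "E b \<in> f_dom W E b c"
    using f_dom_right[OF assms] by (metis atLeastLessThan_iff less_add_same_cancel1 order_refl subset_iff)
  then show ?thesis
    using f_fun_eq[OF equal_entropy_change_refl[OF assms]] by simp
qed

text \<open>Makes the definite description in \<open>temperature\<close> usable. Existence holds
  even if \<open>r1\<close> has the lowest energy, because \<open>f_differentiable\<close> admits
  the reference state.\<close>

lemma temp_derivative:
  assumes "SES W c"
  shows "(f_fun W E r1 c has_real_derivative temp c / T1) (at (E r1) within f_dom W E r1 c)"
proof -
  obtain \<epsilon> where \<epsilon>: "\<epsilon> > 0" "{E r1 ..< E r1 + \<epsilon>} \<subseteq> f_dom W E r1 c"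
    using f_dom_right[OF reference(1) assms] by metis
  obtain D where D: "(f_fun W E r1 c has_real_derivative D) (at (E r1) within f_dom W E r1 c)"
    using f_differentiable[OF reference(1) assms] real_differentiable_def by blast
  have "(THE D. (f_fun W E r1 c has_real_derivative D) (at (E r1) within f_dom W E r1 c)) = D"
    using D real_derivative_within_unique[OF _ D \<epsilon>(2,1)] by (intro the_equality)
  then have "temp c / T1 = D"
    using reference(2) by (simp add: temperature_def)
  then show ?thesis using D by simp
qed

lemma temp_nonneg:
  assumes "SES W c"
  shows "temp c \<ge> 0"
proof -
  obtain \<epsilon> where \<epsilon>: "\<epsilon> > 0" "{E r1 ..< E r1 + \<epsilon>} \<subseteq> f_dom W E r1 c"
    using f_dom_right[OF reference(1) assms] by metis
  have "(f_fun W E r1 c has_real_derivative temp c / T1) (at (E r1) within {E r1 ..< E r1 + \<epsilon>})"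
    using temp_derivative[OF assms] \<epsilon>(2) has_field_derivative_subset by blast
  then have "((\<lambda>e. (f_fun W E r1 c e - f_fun W E r1 c (E r1)) / (e - E r1)) \<longlongrightarrow> temp c / T1)
      (at (E r1) within {E r1 ..< E r1 + \<epsilon>})"
    by (simp add: has_field_derivative_iff)
  moreover have "\<forall>\<^sub>F e in at (E r1) within {E r1 ..< E r1 + \<epsilon>}.
      0 \<le> (f_fun W E r1 c e - f_fun W E r1 c (E r1)) / (e - E r1)"
    unfolding eventually_at_filter
  proof (intro always_eventually allI impI)
    fix e assume e: "e \<noteq> E r1" "e \<in> {E r1 ..< E r1 + \<epsilon>}"
    have "E r1 \<in> {E r1 ..< E r1 + \<epsilon>}" using \<epsilon>(1) by simp
    then have "f_fun W E r1 c (E r1) \<le> f_fun W E r1 c e"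
      by (intro f_fun_mono) (use e \<epsilon>(2) reference(1) assms in auto)
    then show "0 \<le> (f_fun W E r1 c e - f_fun W E r1 c (E r1)) / (e - E r1)"
      using e by simp
  qed
  moreover have "at (E r1) within {E r1 ..< E r1 + \<epsilon>} \<noteq> bot"
    using \<epsilon>(1) by (simp add: trivial_limit_within islimpt_Ico)
  ultimately have "0 \<le> temp c / T1"
    by (rule tendsto_lowerbound)
  then show ?thesis using reference(2) by (simp add: zero_le_divide_iff)
qed

lemma temp_pos:
  assumes "SES W c" "\<not> lowest_SES W E c"
  shows "temp c > 0"
  using temp_nonneg[OF assms(1)] temperature_vanishing[OF assms(1)] assms(2) by fastforce

text \<open>Chain rule: to the right of \<open>E r1\<close>, the function from \<open>r1\<close> to
  \<open>c\<close> is the one from \<open>r1\<close> to \<open>b\<close> followed by the one from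
  \<open>b\<close> to \<open>c\<close>. The derivatives at \<open>E r1\<close> give the quotient, as
  \<open>temp b\<close> is positive.\<close>

lemma f_derivative:
  assumes b: "SES W b" "\<not> lowest_SES W E b" and c: "SES W c"
  shows "(f_fun W E b c has_real_derivative temp c / temp b) (at (E b) within f_dom W E b c)"
proof -
  define f g h where "f = f_fun W E b c" and "g = f_fun W E r1 b" and "h = f_fun W E r1 c"
  obtain \<epsilon>1 where \<epsilon>1: "\<epsilon>1 > 0" "{E r1 ..< E r1 + \<epsilon>1} \<subseteq> f_dom W E r1 b"
    using f_dom_right[OF reference(1) b(1)] by metis
  obtain \<epsilon>2 where \<epsilon>2: "\<epsilon>2 > 0" "{E r1 ..< E r1 + \<epsilon>2} \<subseteq> f_dom W E r1 c"
    using f_dom_right[OF reference(1) c] by metis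
  obtain \<epsilon>3 where \<epsilon>3: "\<epsilon>3 > 0" "{E b ..< E b + \<epsilon>3} \<subseteq> f_dom W E b c"
    using f_dom_right[OF b(1) c] by metis
  have dg: "(g has_real_derivative temp b / T1) (at (E r1) within f_dom W E r1 b)"
    and dh: "(h has_real_derivative temp c / T1) (at (E r1) within f_dom W E r1 c)"
    unfolding g_def h_def using temp_derivative b c by simp_all
  obtain D where D: "(f has_real_derivative D) (at (E b) within f_dom W E b c)"
    unfolding f_def using f_differentiable[OF b(1) c] b(2) real_differentiable_def by blast
  have base: "g (E r1) = E b" unfolding g_def by (rule f_fun_base[OF reference(1) b(1)])
  have "(g \<longlongrightarrow> E b) (at (E r1) within f_dom W E r1 b)"
    using dg base by (metis DERIV_continuous continuous_within)
  then have "\<forall>\<^sub>F e in at (E r1) within f_dom W E r1 b. g e < E b + \<epsilon>3"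
    by (rule order_tendstoD(2)) (simp add: \<epsilon>3(1))
  then obtain \<delta>0 where \<delta>0: "\<delta>0 > 0"
    "\<And>e. e \<in> f_dom W E r1 b \<Longrightarrow> e \<noteq> E r1 \<Longrightarrow> dist e (E r1) < \<delta>0 \<Longrightarrow> g e < E b + \<epsilon>3"
    unfolding eventually_at by blast
  \<comment> \<open>Up to this distance both functions starting from \<open>r1\<close> are defined,
    and \<open>g\<close> stays within the interval on which \<open>f\<close> is known to be
    defined.\<close>
  define \<delta> where "\<delta> = min \<delta>0 (min \<epsilon>1 \<epsilon>2)"
  define S where "S = {E r1 ..< E r1 + \<delta>}"
  have \<delta>: "\<delta> > 0" using \<delta>0 \<epsilon>1 \<epsilon>2 by (simp add: \<delta>_def)
  have S: "S \<subseteq> f_dom W E r1 b" "S \<subseteq> f_dom W E r1 c" "E r1 \<in> S"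
  proof -
    have "S \<subseteq> {E r1 ..< E r1 + \<epsilon>1}" "S \<subseteq> {E r1 ..< E r1 + \<epsilon>2}" by (auto simp: S_def \<delta>_def)
    then show "S \<subseteq> f_dom W E r1 b" "S \<subseteq> f_dom W E r1 c" using \<epsilon>1(2) \<epsilon>2(2) by (meson order_trans)+
    show "E r1 \<in> S" using \<delta> by (simp add: S_def)
  qed
  have gS: "g e \<in> f_dom W E b c" if e: "e \<in> S" for e
  proof -
    have "g (E r1) \<le> g e"
      unfolding g_def by (rule f_fun_mono) (use S e b reference(1) in \<open>auto simp: S_def\<close>)
    moreover have "e \<in> f_dom W E r1 b" using S(1) e by blast
    then have "g e < E b + \<epsilon>3"
      using \<delta>0(2)[of e] e base \<epsilon>3(1) by (cases "e = E r1") (auto simp: S_def \<delta>_def dist_real_def)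
    ultimately show ?thesis using base \<epsilon>3(2) by auto
  qed
  have hS: "h e = (f \<circ> g) e" if e: "e \<in> S" for e
  proof -
    obtain r2 b2 where M1: "equal_entropy_change W r1 r2 b b2" "E r2 = e" "E b2 = g e"
      using f_domE[of e r1 b] S e reference(1) b(1) unfolding g_def by blast
    obtain b3 c3 where M2: "equal_entropy_change W b b3 c c3" "E b3 = g e" "E c3 = f (g e)"
      using f_domE[OF gS[OF e] b(1) c] unfolding f_def by metis
    \<comment> \<open>Both are stable states in the regions of \<open>b\<close> with energy
      \<open>g e\<close>, so the two entropy changes can be composed.\<close>
    have "b3 = b2"
    proof (rule SES_unique)
      show "same_regions W b3 b2"
        using equal_entropy_change_SES[OF M1(1)] equal_entropy_change_SES[OF M2(1)]
        by (simp add: same_regions_def)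
    qed (use equal_entropy_change_SES[OF M1(1)] equal_entropy_change_SES[OF M2(1)] M1 M2 in simp_all)
    then have "equal_entropy_change W r1 r2 c c3"
      using equal_entropy_change_trans[OF M1(1)] M2(1) by simp
    then have "h (E r2) = E c3"
      unfolding h_def by (rule f_fun_eq) (use S e M1(2) in auto)
    then show ?thesis using M1 M2 by simp
  qed
  have "(f \<circ> g has_real_derivative D * (temp b / T1)) (at (E r1) within S)"
  proof (rule DERIV_image_chain)
    show "(f has_real_derivative D) (at (g (E r1)) within g ` S)"
      using D gS unfolding base by (intro has_field_derivative_subset[OF D]) auto
    show "(g has_real_derivative temp b / T1) (at (E r1) within S)"
      using has_field_derivative_subset[OF dg S(1)] .
  qed
  then have "(h has_real_derivative D * (temp b / T1)) (at (E r1) within S)"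
    by (rule has_field_derivative_transform_within[OF _ zero_less_one S(3)]) (use hS in auto)
  moreover have "(h has_real_derivative temp c / T1) (at (E r1) within S)"
    using has_field_derivative_subset[OF dh S(2)] .
  ultimately have "D * (temp b / T1) = temp c / T1"
    by (rule real_derivative_within_unique[of _ _ _ _ _ \<delta>]) (use \<delta> in \<open>simp_all add: S_def\<close>)
  then have "D = temp c / temp b"
    using reference(2) temp_pos[OF b] by (simp add: field_simps)
  then show ?thesis using D by (simp add: f_def)
qed

text \<open>The functions f from \<open>r1\<close> to \<open>a\<close> and from \<open>r1\<close> to
  \<open>b\<close> agree on an interval to the right of \<open>E r1\<close>, so their derivatives
  there agree.\<close>

lemma temp_eqI:
  assumes a: "SES W a" and b: "SES W b" and "interaccessible W a b"
    and eqv: "\<And>a' b'. \<lbrakk>SES W a'; SES W b'; same_regions W a a'; same_regions W b b'; E a' = E b'\<rbrakk>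
         \<Longrightarrow> interaccessible W a' b'"
  shows "temp a = temp b"
proof -
  have le: "E a' \<le> E b'"
    if a: "SES W a" and b: "SES W b" and ab: "interaccessible W a b"
      and eqv: "\<And>a' b'. \<lbrakk>SES W a'; SES W b'; same_regions W a a'; same_regions W b b'; E a' = E b'\<rbrakk>
         \<Longrightarrow> interaccessible W a' b'"
      and Ma: "equal_entropy_change W r1 r2 a a'" and Mb: "equal_entropy_change W r1 r3 b b'"
      and r: "E r2 = E r3"
    for a b a' b' r2 r3
  proof (rule ccontr)
    assume less: "\<not> E a' \<le> E b'"
    note sa = equal_entropy_change_SES[OF Ma] note sb = equal_entropy_change_SES[OF Mb]
    \<comment> \<open>Raise \<open>b'\<close> to the energy of \<open>a'\<close>. By
      \<open>eqv\<close> the result is interaccessible with \<open>a'\<close>, so it corresponds to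
      the same change of the reference system, and monotonicity forbids its energy to exceed that of
      \<open>b'\<close>.\<close>
    obtain b'' where b'': "SES W b''" "same_regions W b' b''" "E b'' = E a'"
      using SES_raise[OF sb(4), of "E a'"] less by auto
    have sr: "same_regions W b b''" using same_regions_trans[OF sb(6) b''(2)] .
    have "equal_entropy_change W r1 r2 b b''"
      by (rule equal_entropy_change_cong[OF Ma ab eqv b b''(1) sr])
        (use sa b'' sr in simp_all)
    then have "E b'' \<le> E b'" using equal_entropy_change_mono Mb r by simp
    then show False using less b''(3) by simp
  qed
  obtain \<epsilon>1 where \<epsilon>1: "\<epsilon>1 > 0" "{E r1 ..< E r1 + \<epsilon>1} \<subseteq> f_dom W E r1 a"
    using f_dom_right[OF reference(1) a] by metis
  obtain \<epsilon>2 where \<epsilon>2: "\<epsilon>2 > 0" "{E r1 ..< E r1 + \<epsilon>2} \<subseteq> f_dom W E r1 b"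
    using f_dom_right[OF reference(1) b] by metis
  define S where "S = {E r1 ..< E r1 + min \<epsilon>1 \<epsilon>2}"
  have S: "S \<subseteq> f_dom W E r1 a" "S \<subseteq> f_dom W E r1 b" "E r1 \<in> S"
    using order_trans[OF _ \<epsilon>1(2)] order_trans[OF _ \<epsilon>2(2)] \<epsilon>1(1) \<epsilon>2(1) by (simp_all add: S_def)
  have eq: "f_fun W E r1 b e = f_fun W E r1 a e" if e: "e \<in> S" for e
  proof -
    obtain r2 a' where Ma: "equal_entropy_change W r1 r2 a a'" "E r2 = e" "E a' = f_fun W E r1 a e"
      using f_domE[of e r1 a] S e reference(1) a by blast
    obtain r3 b' where Mb: "equal_entropy_change W r1 r3 b b'" "E r3 = e" "E b' = f_fun W E r1 b e"
      using f_domE[of e r1 b] S e reference(1) b by blast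
    have "E a' \<le> E b'"
      by (rule le[OF a b assms(3) eqv Ma(1) Mb(1)]) (use Ma Mb in simp_all)
    moreover have "E b' \<le> E a'"
      by (rule le[OF b a interaccessible_sym[OF assms(3)] interaccessible_sym[OF eqv] Mb(1) Ma(1)])
        (use Ma Mb in simp_all)
    ultimately show ?thesis using Ma(3) Mb(3) by simp
  qed
  have "(f_fun W E r1 a has_real_derivative temp a / T1) (at (E r1) within S)"
    using has_field_derivative_subset[OF temp_derivative[OF a] S(1)] .
  then have "(f_fun W E r1 b has_real_derivative temp a / T1) (at (E r1) within S)"
    by (rule has_field_derivative_transform_within[OF _ zero_less_one S(3)]) (use eq in auto)
  moreover have "(f_fun W E r1 b has_real_derivative temp b / T1) (at (E r1) within S)"
    using has_field_derivative_subset[OF temp_derivative[OF b] S(2)] .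
  ultimately have "temp a / T1 = temp b / T1"
    by (rule real_derivative_within_unique[of _ _ _ _ _ "min \<epsilon>1 \<epsilon>2"]) (use \<epsilon>1(1) \<epsilon>2(1) in \<open>simp_all add: S_def\<close>)
  then show ?thesis using reference(2) by simp
qed

section \<open>Energy of composites and copies, and the cost of equal entropy increments\<close>

lemma energy_compose:
  assumes a: "SES W a" "SES W a'" "same_regions W a a'" and c: "SES W c" "apart W a c"
  shows "E (a' \<bowtie> c) - E (a \<bowtie> c) = E a' - E a"
proof -
  \<comment> \<open>For increasing energy there is a weight process from \<open>a\<close> to
    \<open>a'\<close>; carried out with \<open>c\<close> idle it does the same work on the
    composite. The other case follows by exchanging the two states.\<close>
  have le: "E (a' \<bowtie> c) - E (a \<bowtie> c) = E a' - E a"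
    if a: "SES W a" "SES W a'" "same_regions W a a'" and ap: "apart W a c" and le: "E a \<le> E a'" for a a'
  proof -
    obtain w where w: "weight_process W a a' w"
      using SES_accessible[OF a] le by (auto simp: accessible_def)
    then have "weight_process W (a \<bowtie> c) (a' \<bowtie> c) w"
      using weight_process_idle[OF SES_systems[OF a(1)] SES_systems[OF c(1)] ap _ w] c(1) by (simp add: SES_def)
    then have "E (a' \<bowtie> c) - E (a \<bowtie> c) = - w"
      by (rule energy_balance[rotated]) (intro compose_systems SES_systems a c ap)
    then show ?thesis using energy_balance[OF SES_systems[OF a(1)] w] by simp
  qed
  show ?thesis
  proof (cases "E a \<le> E a'")
    case True
    then show ?thesis using le[OF a c(2)] by simp
  next
    case False
    moreover have "apart W a' c" using a(3) c(2) by (simp add: apart_def same_regions_def)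
    ultimately show ?thesis using le[OF a(2,1) same_regions_sym[OF a(3)]] by simp
  qed
qed

lemma energy_copy:
  assumes \<sigma>: "identical_copy W (constituents W a) A' \<sigma>" and a: "SES W a" "SES W a'" "same_regions W a a'"
  shows "E (\<sigma> a') - E (\<sigma> a) = E a' - E a"
proof -
  have le: "E (\<sigma> a') - E (\<sigma> a) = E a' - E a"
    if a: "SES W a" "SES W a'" "same_regions W a a'" and le: "E a \<le> E a'" for a a'
  proof -
    obtain w where w: "weight_process W a a' w"
      using SES_accessible[OF a] le by (auto simp: accessible_def)
    then show ?thesis
      using energy_balance[OF SES_systems[OF a(1)] w]
        energy_balance[OF SES_systems[OF copy_SES[OF \<sigma> a(1)]] copy_weight_process[OF \<sigma> w]] by simp
  qed
  show ?thesis
    using le[OF a] le[OF a(2,1) same_regions_sym[OF a(3)]] by (cases "E a \<le> E a'") simp_all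
qed

text \<open>
  The system in state \<open>b1\<close> and its copy in the same state are in mutual stable equilibrium, so that
  a state of equal entropy must have a higher energy.
\<close>

lemma energy_increments_less:
  assumes M: "equal_entropy_change W b0 b1 b1 b2" and sr: "same_regions W b0 b1" and "b0 \<noteq> b1"
  shows "E b1 - E b0 < E b2 - E b1"
proof (rule ccontr)
  assume "\<not> E b1 - E b0 < E b2 - E b1"
  then have ge: "E b2 - E b1 \<le> E b1 - E b0" by simp
  note s = equal_entropy_change_SES[OF M]
  obtain \<B> where \<B>: "finite \<B>" "\<B> \<subseteq> systems W" "constituents W b0 \<in> \<B>"
    "\<And>C' \<sigma>. \<lbrakk>identical_copy W (constituents W b1) C' \<sigma>; C' \<inter> \<Union>\<B> = {}\<rbrakk>
        \<Longrightarrow> interaccessible W (b0 \<bowtie> \<sigma> b2) (b1 \<bowtie> \<sigma> b1)"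
    using equal_entropy_changeE[OF M] by metis
  obtain C' \<sigma> where \<sigma>: "identical_copy W (constituents W b1) C' \<sigma>" "C' \<inter> \<Union>\<B> = {}" "C' \<in> systems W"
      "constituents W b1 \<inter> C' = {}"
    by (rule fresh_copy[OF s(3) \<B>(1,2)])
  have C: "constituents W (\<sigma> b1) = C'" "constituents W (\<sigma> b2) = C'"
    using copy_constituents[OF \<sigma>(1)] s(8) by simp_all
  have ap: "apart W b0 (\<sigma> b2)" "apart W b1 (\<sigma> b1)" "apart W b1 (\<sigma> b2)"
    "apart W (\<sigma> b1) b1" using C \<sigma>(4) s(7) by (simp_all add: apart_def Int_commute)
  have srs: "same_regions W (\<sigma> b1) (\<sigma> b2)" using copy_same_regions[OF \<sigma>(1)] s(6) by simp
  have P: "SES W (b1 \<bowtie> \<sigma> b1)"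
    using copy_mutual_SES[OF s(3) \<sigma>(1)] by (simp add: mutual_SES_def)
  have Q: "same_regions W (b1 \<bowtie> \<sigma> b1) (b0 \<bowtie> \<sigma> b2)"
    using regions_compose[OF ap(2), of b0 "\<sigma> b2"] ap sr srs constituents_compose
    by (simp add: same_regions_def)
  have acc: "accessible W (b1 \<bowtie> \<sigma> b1) (b0 \<bowtie> \<sigma> b2)"
    using \<B>(4)[OF \<sigma>(1,2)] by (simp add: interaccessible_def)
  \<comment> \<open>Passing through \<open>b1 \<bowtie> \<sigma> b2\<close>, the energy changes from
    \<open>b1 \<bowtie> \<sigma> b1\<close> to \<open>b0 \<bowtie> \<sigma> b2\<close> by the second
    increment minus the first, which is at most 0 by \<open>ge\<close>. The second law excludes a
    negative value, and 0 would make the two states equal.\<close>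
  have "E (b1 \<bowtie> \<sigma> b2) - E (b0 \<bowtie> \<sigma> b2) = E b1 - E b0"
    by (rule energy_compose) (use s sr ap copy_SES[OF \<sigma>(1)] in simp_all)
  moreover have "E (\<sigma> b2 \<bowtie> b1) - E (\<sigma> b1 \<bowtie> b1) = E (\<sigma> b2) - E (\<sigma> b1)"
    by (rule energy_compose) (use s srs ap copy_SES[OF \<sigma>(1)] in simp_all)
  moreover have "E (\<sigma> b2) - E (\<sigma> b1) = E b2 - E b1"
    by (rule energy_copy[OF \<sigma>(1)]) (use s in simp_all)
  moreover have "E (b1 \<bowtie> \<sigma> b1) \<le> E (b0 \<bowtie> \<sigma> b2)"
    by (rule SES_accessible_energy_le[OF P Q acc])
  ultimately have "E (b0 \<bowtie> \<sigma> b2) = E (b1 \<bowtie> \<sigma> b1)"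
    using ge compose_commute[OF ap(2)] compose_commute[OF ap(3)] by simp
  then have "b0 \<bowtie> \<sigma> b2 = b1 \<bowtie> \<sigma> b1"
    by (rule SES_accessible_same_energy[OF P Q acc])
  then show False
    using compose_cancel[OF ap(1)] s(7) C assms(3) by metis
qed

end

section \<open>Integration and concavity\<close>

text \<open>
  A relation on pairs of energy increments that is described infinitesimally by \<open>dk / dq = T k / T q\<close>
  contains all pairs of increments with the same increment of entropy \<open>S\<close>: along the curve
  \<open>S k = S q + const\<close> it is locally, hence globally, satisfied.
\<close>

lemma equal_increments_related:
  fixes S T :: "real \<Rightarrow> real" and M :: "real \<Rightarrow> real \<Rightarrow> real \<Rightarrow> real \<Rightarrow> bool"
  assumes T: "\<And>e. e0 < e \<Longrightarrow> 0 < T e"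
    and S: "\<And>e. e0 < e \<Longrightarrow> (S has_real_derivative 1 / T e) (at e)"
    and sym: "\<And>q q' k k'. M q q' k k' \<Longrightarrow> M q' q k' k"
    and join: "\<And>q q' q'' k k' k''. M q q' k k' \<Longrightarrow> M q' q'' k' k'' \<Longrightarrow> M q q'' k k''"
    and unique: "\<And>q q' k k' k''. M q q' k k' \<Longrightarrow> M q q' k k'' \<Longrightarrow> k' = k''"
    and loc: "\<And>q k. e0 < q \<Longrightarrow> e0 < k \<Longrightarrow> \<exists>f \<epsilon>. 0 < \<epsilon> \<and>
        (\<forall>e\<in>ball q \<epsilon>. e0 < e \<and> e0 < f e \<and> M q e k (f e)) \<and> f q = k \<and>
        (f has_real_derivative T k / T q) (at q)"
    and q: "e0 < q" "e0 < q'" and k: "e0 < k" "e0 < k'" and eq: "S q' - S q = S k' - S k"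
  shows "M q q' k k'"
proof -
  have mono: "S x < S y" if "e0 < x" "x < y" for x y
  proof (rule DERIV_pos_imp_increasing[OF that(2)])
    show "\<exists>y. (S has_real_derivative y) (at z) \<and> 0 < y" if "x \<le> z" "z \<le> y" for z
      using S[of z] T[of z] that \<open>e0 < x\<close> by auto
  qed
  have mono_le: "S x \<le> S y" if "e0 < x" "x \<le> y" for x y
    using mono[of x y] that less_eq_real_def by metis
  have inj: "x = y" if "S x = S y" "e0 < x" "e0 < y" for x y
    using that mono by (metis linorder_neqE_linordered_idom order_less_irrefl)
  have cont: "continuous_on {x..y} S" if "e0 < x" for x y
    by (rule DERIV_continuous_on, rule has_field_derivative_at_within, rule S) (use that in auto)
  have *: "M q q' k k'" if q: "e0 < q" "q \<le> q'" and k: "e0 < k" "e0 < k'"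
    and eq: "S q' - S q = S k' - S k" for q q' k k'
  proof -
    have "S q \<le> S q'" using mono_le[OF q] .
    then have kk: "k \<le> k'" using mono[OF k(2), of k] eq by fastforce
    \<comment> \<open>Parametrizes the curve of constant entropy difference through
      \<open>(q, k)\<close>; by injectivity of \<open>S\<close> it ends at
      \<open>(q', k')\<close>.\<close>
    have "\<exists>\<kappa>\<ge>k. \<kappa> \<le> k' \<and> S \<kappa> = S e + (S k - S q)" if e: "e \<in> {q..q'}" for e
    proof (rule IVT')
      have "S q \<le> S e" using mono_le[of q e] e q by simp
      then show "S k \<le> S e + (S k - S q)" by simp
      have "S e \<le> S q'" using mono_le[of e q'] e q by simp
      then show "S e + (S k - S q) \<le> S k'" using eq by simp
      show "continuous_on {k..k'} S"
        by (rule cont[OF k(1)])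
    qed (fact kk)
    then obtain \<kappa> where \<kappa>: "\<And>e. e \<in> {q..q'} \<Longrightarrow> k \<le> \<kappa> e \<and> S (\<kappa> e) = S e + (S k - S q)"
      by metis
    \<comment> \<open>Being related along the curve is an equivalence relation on a connected
      interval, so it suffices that its classes contain neighbourhoods.\<close>
    have "M q q' (\<kappa> q) (\<kappa> q')"
    proof (rule connected_equivalence_relation[where R = "\<lambda>x y. M x y (\<kappa> x) (\<kappa> y)" and S = "{q..q'}"])
      fix e assume e: "e \<in> {q..q'}"
      have gr: "e0 < e" "e0 < \<kappa> e" using e q k \<kappa>[OF e] by auto
      obtain f \<epsilon> where \<epsilon>: "0 < \<epsilon>" and f: "\<And>x. x \<in> ball e \<epsilon> \<Longrightarrow> e0 < x \<and> e0 < f x \<and> M e x (\<kappa> e) (f x)"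
        and fe: "f e = \<kappa> e"
        using loc[OF gr] by metis
      \<comment> \<open>\<open>loc\<close> gives the derivative only at the base point. At another
        point \<open>x\<close> it provides a function \<open>g\<close> based at
        \<open>(x, f x)\<close>, which coincides with \<open>f\<close> near \<open>x\<close> by
        \<open>join\<close> and \<open>unique\<close>.\<close>
      have f': "(f has_real_derivative T (f x) / T x) (at x)" if x: "x \<in> ball e \<epsilon>" for x
      proof -
        obtain g \<delta> where \<delta>: "0 < \<delta>" and g: "\<And>y. y \<in> ball x \<delta> \<Longrightarrow> M x y (f x) (g y)"
          and g': "(g has_real_derivative T (f x) / T x) (at x)"
          using loc[of x "f x"] f[OF x] by metis
        have "g y = f y" if "y \<in> ball e \<epsilon> \<inter> ball x \<delta>" for y
        proof -
          have "M e y (\<kappa> e) (g y)" using join[of e x _ "f x"] f[OF x] g[of y] that by blast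
          then show ?thesis using unique[of e y "\<kappa> e"] f[of y] that by blast
        qed
        moreover have "open (ball e \<epsilon> \<inter> ball x \<delta>)" "x \<in> ball e \<epsilon> \<inter> ball x \<delta>"
          using x \<delta> by auto
        ultimately show ?thesis
          using has_field_derivative_transform_within_open[OF g'] by blast
      qed
      have "f x = \<kappa> x" if x: "x \<in> ball e \<epsilon> \<inter> {q..q'}" for x
      proof -
        \<comment> \<open>The derivative of \<open>S (f x) - S x\<close> vanishes by the quotient
          formula for \<open>f\<close>, so the graph of \<open>f\<close> stays on the curve.\<close>
        have "S (f x) - S x = S (f e) - S e"
        proof (rule has_field_derivative_zero_constant[THEN exE])
          show "convex (ball e \<epsilon>)" by simp
          show "((\<lambda>x. S (f x) - S x) has_real_derivative 0) (at y within ball e \<epsilon>)" if y: "y \<in> ball e \<epsilon>" for y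
          proof -
            have "e0 < y" "e0 < f y" using f[OF y] by auto
            then have "((\<lambda>x. S (f x) - S x) has_real_derivative 1 / T (f y) * (T (f y) / T y) - 1 / T y) (at y)"
              by (intro DERIV_diff DERIV_chain2[OF S f'[OF y]] S)
            then show ?thesis
              using T[of "f y"] \<open>e0 < f y\<close> by (simp add: has_field_derivative_at_within)
          qed
        qed (use x \<epsilon> in auto)
        then have "S (f x) = S (\<kappa> x)"
          using \<kappa>[OF e] \<kappa>[of x] x fe by simp
        then show ?thesis
          using inj[of "f x" "\<kappa> x"] f[of x] \<kappa>[of x] x k by fastforce
      qed
      then have "\<forall>x \<in> {q..q'} \<inter> ball e \<epsilon>. M e x (\<kappa> e) (\<kappa> x)"
        using f by fastforce
      then show "\<exists>N. openin (top_of_set {q..q'}) N \<and> e \<in> N \<and> (\<forall>x\<in>N. M e x (\<kappa> e) (\<kappa> x))"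
        using e \<epsilon> by (intro exI[of _ "{q..q'} \<inter> ball e \<epsilon>"]) auto
    next
      show "M y x (\<kappa> y) (\<kappa> x)" if "M x y (\<kappa> x) (\<kappa> y)" for x y using sym[OF that] .
      show "M x z (\<kappa> x) (\<kappa> z)" if "M x y (\<kappa> x) (\<kappa> y)" "M y z (\<kappa> y) (\<kappa> z)" for x y z
        using join[OF that] .
    qed (use q in simp_all)
    moreover have "\<kappa> q = k" "\<kappa> q' = k'"
      using inj \<kappa>[of q] \<kappa>[of q'] q k eq by auto
    ultimately show ?thesis by simp
  qed
  show ?thesis
  proof (cases "q \<le> q'")
    case True
    then show ?thesis using *[OF q(1) _ k eq] by simp
  next
    case False
    then show ?thesis using *[OF q(2) _ k(2,1)] eq sym by simp
  qed
qed

text \<open>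
  The assumption on consecutive equal increments excludes an interior minimum of the difference
  between \<open>S\<close> and a chord.
\<close>

lemma strict_concave_from_increments:
  fixes S T :: "real \<Rightarrow> real"
  assumes T: "\<And>e. e0 < e \<Longrightarrow> 0 < T e"
    and S: "\<And>e. e0 < e \<Longrightarrow> (S has_real_derivative 1 / T e) (at e)"
    and incr: "\<And>q p k. \<lbrakk>e0 < q; q < p; p < k; S p - S q = S k - S p\<rbrakk> \<Longrightarrow> p - q < k - p"
    and ab: "e0 < a" "a < m" "m < b"
  shows "S m > S a + (S b - S a) / (b - a) * (m - a)"
proof (rule ccontr)
  assume neg: "\<not> ?thesis"
  have mono: "S x < S y" if "e0 < x" "x < y" for x y
  proof (rule DERIV_pos_imp_increasing[OF that(2)])
    show "\<exists>y. (S has_real_derivative y) (at z) \<and> 0 < y" if "x \<le> z" "z \<le> y" for z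
      using S[of z] T[of z] that \<open>e0 < x\<close> by auto
  qed
  have cont: "continuous_on {x..y} S" if "e0 < x" for x y
    by (rule DERIV_continuous_on, rule has_field_derivative_at_within, rule S) (use that in auto)
  define c where "c = (S b - S a) / (b - a)"
  define G where "G e = S e - S a - c * (e - a)" for e
  have ends: "G a = 0" "G b = 0" using ab by (simp_all add: G_def c_def)
  have Gm: "G m \<le> 0" using neg by (simp add: G_def c_def)
  have "continuous_on {a..b} G" unfolding G_def by (intro continuous_intros cont ab)
  then obtain p0 where p0: "p0 \<in> {a..b}" "\<And>e. e \<in> {a..b} \<Longrightarrow> G p0 \<le> G e"
    using continuous_attains_inf[of "{a..b}" G] ab by auto
  \<comment> \<open>If the minimum is attained at an end point its value is 0; then
    \<open>m\<close>, where \<open>G\<close> is at most 0, is an interior minimizer.\<close>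
  obtain p where p: "a < p" "p < b" "\<And>e. e \<in> {a..b} \<Longrightarrow> G p \<le> G e"
  proof (cases "p0 = a \<or> p0 = b")
    case True
    then show ?thesis using that[of m] p0(2) ends Gm ab by fastforce
  next
    case False
    then show ?thesis using that[of p0] p0 by auto
  qed
  define d where "d = min (p - a) (b - p)"
  have d: "0 < d" "a \<le> p - d" "p + d \<le> b" using p by (auto simp: d_def)
  have "G p \<le> G (p - d)" "G p \<le> G (p + d)" using p d by auto
  then have "S p + S p \<le> S (p - d) + S (p + d)" by (simp add: G_def algebra_simps)
  moreover have less: "S (p - d) < S p" using mono[of "p - d" p] d ab by simp
  \<comment> \<open>Minimality on both sides bounds the increment of \<open>S\<close> over
    \<open>[p - d, p]\<close> by that over \<open>[p, p + d]\<close>. So an equal increment is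
    reached at some \<open>k \<le> p + d\<close>, whereas \<open>incr\<close> demands
    \<open>k - p > d\<close>.\<close>
  ultimately obtain k where k: "p \<le> k" "k \<le> p + d" "S k = S p + (S p - S (p - d))"
    using IVT'[of S p "S p + (S p - S (p - d))" "p + d"] d p ab cont[of p "p + d"] by auto
  have "p < k" using k less by (cases "p = k") auto
  then have "p - (p - d) < k - p" using incr[of "p - d" p k] k d ab by simp
  then show False using k by simp
qed

text \<open>\<open>1 / T\<close> is the slope of a concave function. Tangents alone give a weak
  inequality between the slopes at \<open>x\<close> and \<open>y\<close>; the strict chord
  inequality at the midpoint makes it strict.\<close>

lemma strict_mono_from_increments:
  fixes S T :: "real \<Rightarrow> real"
  assumes T: "\<And>e. e0 < e \<Longrightarrow> 0 < T e"
    and S: "\<And>e. e0 < e \<Longrightarrow> (S has_real_derivative 1 / T e) (at e)"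
    and incr: "\<And>q p k. \<lbrakk>e0 < q; q < p; p < k; S p - S q = S k - S p\<rbrakk> \<Longrightarrow> p - q < k - p"
    and xy: "e0 < x" "x < y"
  shows "T x < T y"
proof -
  note chord = strict_concave_from_increments[OF T S incr]
  have "concave_on {e0<..} S"
  proof (rule concave_on_linorderI)
    fix t a b :: real assume t: "0 < t" "t < 1" and ab: "a \<in> {e0<..}" "b \<in> {e0<..}" "a < b"
    define m where "m = (1 - t) * a + t * b"
    have m: "m - a = t * (b - a)" by (simp add: m_def algebra_simps)
    have "b - m = (1 - t) * (b - a)" by (simp add: m_def algebra_simps)
    moreover have "0 < t * (b - a)" "0 < (1 - t) * (b - a)" using t ab by simp_all
    ultimately have "a < m" "m < b" using m by linarith+
    then have "S a + (S b - S a) / (b - a) * (m - a) < S m"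
      by (intro chord) (use ab in simp_all)
    moreover have "(S b - S a) / (b - a) * (m - a) = t * (S b - S a)"
      using ab unfolding m by simp
    moreover have "(1 - t) * S a + t * S b = S a + t * (S b - S a)" by (simp add: algebra_simps)
    ultimately show "S ((1 - t) *\<^sub>R a + t *\<^sub>R b) \<ge> (1 - t) * S a + t * S b"
      by (simp add: m_def)
  qed simp
  then have conv: "convex_on {e0<..} (\<lambda>e. - S e)" by (simp add: concave_on_def)
  have tan: "- S z - - S c \<ge> - (1 / T c) * (z - c)" if "e0 < c" "e0 < z" for c z
  proof (rule convex_on_imp_above_tangent[OF conv])
    show "((\<lambda>e. - S e) has_real_derivative - (1 / T c)) (at c within {e0<..})"
      by (rule has_field_derivative_at_within[OF DERIV_minus[OF S[OF that(1)]]])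
  qed (use that in \<open>simp_all add: interior_open\<close>)
  define h where "h = (y - x) / 2"
  have h: "h > 0" "y = x + 2 * h" using xy by (simp_all add: h_def field_simps)
  have "S x + (S y - S x) / (y - x) * ((x + h) - x) < S (x + h)"
    by (rule chord) (use xy h in simp_all)
  moreover have "(S y - S x) / (y - x) * ((x + h) - x) = (S y - S x) / 2"
    using h by simp
  ultimately have "S x + (S y - S x) / 2 < S (x + h)" by (simp only:)
  then have "S y - S (x + h) < S (x + h) - S x" by (simp add: field_simps)
  moreover have "S (x + h) - S x \<le> 1 / T x * h" using tan[of x "x + h"] xy(1) h(1) by simp
  moreover have "1 / T y * h \<le> S y - S (x + h)" using tan[of y "x + h"] xy h by simp
  ultimately have "1 / T y * h < 1 / T x * h" by linarith
  then have "1 / T y < 1 / T x" using mult_less_cancel_right_pos[OF h(1)] by blast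
  then show ?thesis using T[of x] T[of y] xy by (simp add: field_simps)
qed

section \<open>Monotonicity of the temperature\<close>

context thermodynamics
begin

lemma temp_strict_mono:
  assumes a: "SES W a" and b: "SES W b" and sr: "same_regions W a b" and less: "E a < E b"
  shows "temp a < temp b"
proof -
  define e0 where "e0 = E a"
  \<comment> \<open>Parametrizes by energy the stable states in the regions of \<open>a\<close>,
    with the description used in \<open>temperature_continuous\<close>.\<close>
  define B where "B e = (THE b. SES W b \<and> constituents W b = constituents W a \<and> regions W b = regions W a \<and> E b = e)" for e
  have B_eq: "B (E c) = c" if "SES W c" "same_regions W a c" for c
    unfolding B_def
  proof (rule the_equality)
    show "d = c" if "SES W d \<and> constituents W d = constituents W a \<and> regions W d = regions W a \<and> E d = E c" for d
      by (rule SES_unique) (use that \<open>SES W c\<close> \<open>same_regions W a c\<close> in \<open>simp_all add: same_regions_def\<close>)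
  qed (use that in \<open>simp add: same_regions_def\<close>)
  have B: "SES W (B e)" "same_regions W a (B e)" "E (B e) = e" if e: "e0 \<le> e" for e
  proof -
    obtain c where "SES W c" "same_regions W a c" "E c = e"
      using SES_raise[OF a, of e] e by (metis e0_def)
    then show "SES W (B e)" "same_regions W a (B e)" "E (B e) = e" using B_eq by auto
  qed
  have BB: "same_regions W (B e) (B e')" if "e0 \<le> e" "e0 \<le> e'" for e e'
    using B(2)[OF that(1)] B(2)[OF that(2)] by (simp add: same_regions_def)
  define T where "T e = temp (B e)" for e
  \<comment> \<open>Such a state lies strictly above \<open>a\<close> in the same regions, so the
    positivity and differentiability results apply to it.\<close>
  have notlow: "\<not> lowest_SES W E (B e)" if e: "e0 < e" for e
  proof
    assume "lowest_SES W E (B e)"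
    then have "E (B e) \<le> E a"
      unfolding lowest_SES_def using a same_regions_sym[OF B(2)[of e]] e by simp
    then show False using B(3)[of e] e by (simp add: e0_def)
  qed
  have Tpos: "0 < T e" if e: "e0 < e" for e
    unfolding T_def by (rule temp_pos[OF B(1) notlow]) (use e in simp_all)
  have "continuous_on {E b |b. SES W b \<and> constituents W b = constituents W a \<and> regions W b = regions W a} T"
    unfolding T_def B_def by (rule temperature_continuous[OF SES_systems[OF a]])
  moreover have "{e0..} \<subseteq> {E b |b. SES W b \<and> constituents W b = constituents W a \<and> regions W b = regions W a}"
  proof
    fix e assume "e \<in> {e0..}"
    then have "E (B e) = e" "SES W (B e)" "constituents W (B e) = constituents W a" "regions W (B e) = regions W a"
      using B[of e] by (simp_all add: same_regions_def)
    then show "e \<in> {E b |b. SES W b \<and> constituents W b = constituents W a \<and> regions W b = regions W a}"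
      by (intro CollectI exI[of _ "B e"]) simp
  qed
  ultimately have cont: "continuous_on {e0..} T" by (rule continuous_on_subset)
  \<comment> \<open>The entropy as an antiderivative of \<open>1 / T\<close>, on the open half-line
    only, because \<open>T\<close> may vanish at \<open>e0\<close>.\<close>
  have "\<exists>S. \<forall>e. ereal e0 < ereal e \<longrightarrow> ereal e < \<infinity> \<longrightarrow> (S has_vector_derivative 1 / T e) (at e)"
  proof (rule einterval_antiderivative)
    fix e assume "ereal e0 < ereal e"
    then have e: "e \<in> {e0<..}" by simp
    have "continuous_on {e0<..} (\<lambda>e. 1 / T e)"
      by (intro continuous_intros continuous_on_subset[OF cont]) (use Tpos in fastforce)+
    then show "isCont (\<lambda>e. 1 / T e) e"
      using e continuous_on_eq_continuous_at[OF open_greaterThan] by blast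
  qed simp
  then obtain S where S: "\<And>e. e0 < e \<Longrightarrow> (S has_real_derivative 1 / T e) (at e)"
    by (auto simp: has_real_derivative_iff_has_vector_derivative)
  \<comment> \<open>The bounds keep all energies where \<open>E (B e) = e\<close>, so that equality
    of states yields equality of energies.\<close>
  define M where "M q q' k k' \<longleftrightarrow> e0 < q \<and> e0 < q' \<and> e0 < k \<and> e0 < k' \<and>
      equal_entropy_change W (B q) (B q') (B k) (B k')" for q q' k k'
  have loc: "\<exists>f \<epsilon>. 0 < \<epsilon> \<and> (\<forall>e\<in>ball q \<epsilon>. e0 < e \<and> e0 < f e \<and> M q e k (f e)) \<and> f q = k \<and>
        (f has_real_derivative T k / T q) (at q)" if q: "e0 < q" and k: "e0 < k" for q k
  proof -
    define f where "f = f_fun W E (B q) (B k)"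
    have Bq: "SES W (B q)" "E (B q) = q" "\<not> lowest_SES W E (B q)" and Bk: "SES W (B k)" "E (B k) = k" "\<not> lowest_SES W E (B k)"
      using B notlow q k by simp_all
    obtain \<epsilon>1 where \<epsilon>1: "0 < \<epsilon>1" "{q ..< q + \<epsilon>1} \<subseteq> f_dom W E (B q) (B k)" "{q - \<epsilon>1 <.. q} \<subseteq> f_dom W E (B q) (B k)"
      using f_defined[OF Bq(1) Bk(1)] Bq Bk by auto
    have "ball q \<epsilon>1 \<subseteq> {q ..< q + \<epsilon>1} \<union> {q - \<epsilon>1 <.. q}" by (auto simp: dist_real_def)
    then have dom: "ball q \<epsilon>1 \<subseteq> f_dom W E (B q) (B k)" using \<epsilon>1 by (meson Un_least order_trans)
    have "(f has_real_derivative T k / T q) (at q within f_dom W E (B q) (B k))"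
      using f_derivative[OF Bq(1,3) Bk(1)] unfolding f_def T_def Bq(2) .
    then have "(f has_real_derivative T k / T q) (at q within ball q \<epsilon>1)"
      using dom by (rule has_field_derivative_subset)
    then have f': "(f has_real_derivative T k / T q) (at q)"
      using \<epsilon>1(1) by (simp add: at_within_open[OF _ open_ball])
    have fq: "f q = k" using f_fun_base[OF Bq(1) Bk(1)] Bq(2) Bk(2) by (simp add: f_def)
    have "(f \<longlongrightarrow> k) (at q)"
      using DERIV_isCont[OF f'] fq by (simp add: isCont_def)
    then have "\<forall>\<^sub>F e in at q. e0 < f e" by (rule order_tendstoD(1)) (rule k)
    then obtain \<epsilon>2 where \<epsilon>2: "0 < \<epsilon>2" "\<And>e. e \<noteq> q \<Longrightarrow> dist e q < \<epsilon>2 \<Longrightarrow> e0 < f e"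
      unfolding eventually_at by blast
    \<comment> \<open>Within this radius \<open>f\<close> is defined, its values exceed
      \<open>e0\<close>, and so do its arguments.\<close>
    define \<epsilon> where "\<epsilon> = min \<epsilon>1 (min \<epsilon>2 (q - e0))"
    have "e0 < e \<and> e0 < f e \<and> M q e k (f e)" if e: "e \<in> ball q \<epsilon>" for e
    proof -
      have 1: "e0 < e" using e by (auto simp: \<epsilon>_def dist_real_def)
      have 2: "e0 < f e" using e \<epsilon>2(2)[of e] fq k by (cases "e = q") (auto simp: \<epsilon>_def dist_commute)
      have "e \<in> ball q \<epsilon>1" using e by (auto simp: \<epsilon>_def)
      then have "e \<in> f_dom W E (B q) (B k)" using dom by blast
      then obtain b2 c2 where M2: "equal_entropy_change W (B q) b2 (B k) c2" "E b2 = e" "E c2 = f e"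
        unfolding f_def by (rule f_domE[OF _ Bq(1) Bk(1)])
      note s = equal_entropy_change_SES[OF M2(1)]
      have "B (E b2) = b2" "B (E c2) = c2"
        using B_eq[OF s(2)] B_eq[OF s(4)] same_regions_trans[OF B(2) s(5)] same_regions_trans[OF B(2) s(6)] q k
        by simp_all
      then show ?thesis using 1 2 q k M2 by (simp add: M_def)
    qed
    moreover have "0 < \<epsilon>" using \<epsilon>1 \<epsilon>2 q by (simp add: \<epsilon>_def)
    ultimately show ?thesis using fq f' by blast
  qed
  have M: "M q q' k k'" if "e0 < q" "e0 < q'" "e0 < k" "e0 < k'" "S q' - S q = S k' - S k" for q q' k k'
  proof (rule equal_increments_related[OF Tpos S _ _ _ loc that])
    show "M q' q k' k" if "M q q' k k'" for q q' k k'
      using that equal_entropy_change_sym by (simp add: M_def)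
    show "M q q'' k k''" if "M q q' k k'" "M q' q'' k' k''" for q q' q'' k k' k''
      using that equal_entropy_change_join unfolding M_def by metis
    show "k' = k''" if "M q q' k k'" "M q q' k k''" for q q' k k' k''
    proof -
      have "B k' = B k''" using that equal_entropy_change_unique unfolding M_def by metis
      moreover have "e0 \<le> k'" "e0 \<le> k''" using that unfolding M_def by linarith+
      ultimately show ?thesis using B(3) by metis
    qed
  qed
  have incr: "p - q < k - p" if "e0 < q" "q < p" "p < k" "S p - S q = S k - S p" for q p k
  proof -
    have "equal_entropy_change W (B q) (B p) (B p) (B k)"
      using M[of q p p k] that by (simp add: M_def)
    moreover have "same_regions W (B q) (B p)" using BB that by simp
    moreover have "B q \<noteq> B p" using B(3)[of q] B(3)[of p] that by auto
    ultimately have "E (B p) - E (B q) < E (B k) - E (B p)" by (rule energy_increments_less)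
    then show ?thesis using B(3) that by simp
  qed
  have mono: "T x < T y" if "e0 < x" "x < y" for x y
    by (rule strict_mono_from_increments[OF Tpos S incr that])
  \<comment> \<open>At \<open>e0\<close> continuity gives only a weak inequality; the intermediate
    energy \<open>m\<close> makes the final one strict.\<close>
  define m where "m = (e0 + E b) / 2"
  have m: "e0 < m" "m < E b" using less by (simp_all add: m_def e0_def field_simps)
  have "T e0 \<le> T m"
  proof (rule continuous_le_on_closure[where S = "{e0<..<m}" and f = T and x = e0])
    show "continuous_on (closure {e0<..<m}) T"
      using m continuous_on_subset[OF cont] by simp
    show "T e \<le> T m" if "e \<in> {e0<..<m}" for e
      using mono[of e m] that by simp
  qed (use m in simp)
  also have "T m < T (E b)" using mono m by simp
  finally show ?thesis
    using B_eq[OF a] B_eq[OF b sr] by (simp add: T_def e0_def same_regions_def)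
qed

end

section \<open>From fixed regions to fixed parameters\<close>

theorem corollary8:
  fixes W :: "('p, 's, 'r, 'z) world_scheme"
    and E :: "'s \<Rightarrow> real" and r1 :: 's and T1 :: real
    and A :: "'p set" and s :: nat and \<beta> :: "nat \<Rightarrow> 'r \<Rightarrow> real" and v :: "nat \<Rightarrow> real"
  assumes "thermodynamics W E r1 T1"
    and "A \<in> systems W"
    and "parameters W E A s \<beta>"
  shows "\<exists>T. strict_mono_on (E ` SES_with_parameters W A s \<beta> v) T \<and>
             (\<forall>a \<in> SES_with_parameters W A s \<beta> v. temperature W E r1 T1 a = T (E a))"
proof -
  interpret thermodynamics W E r1 T1 by fact
  define P where "P = SES_with_parameters W A s \<beta> v"
  have P: "a \<in> P \<longleftrightarrow> SES W a \<and> constituents W a = A \<and> (\<forall>i<s. \<beta> i (regions W a) = v i)" for a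
    by (simp add: P_def SES_with_parameters_def)
  have P_same_regions: "b \<in> P" if "a \<in> P" "SES W b" "same_regions W a b" for a b
    using that by (simp add: P same_regions_def)
  \<comment> \<open>Equal energy and equal parameters put both states into one set of equivalent
    states, whose members are joined by reversible weight processes.\<close>
  have eqv: "interaccessible W a b" if ab: "a \<in> P" "b \<in> P" "E a = E b" for a b
  proof -
    have "parametrizes W E A {..<s} \<beta>" using assms(3) by (simp add: parameters_def)
    then obtain Q where Q: "equivalent_SES_set W A Q" "a \<in> Q" "b \<in> Q"
      unfolding parametrizes_def using ab P by (metis lessThan_iff)
    show ?thesis
    proof (cases "a = b")
      case True
      then show ?thesis using SES_interaccessible_refl ab P by simp
    next
      case False
      then have "reversible_weight_process W a b 0" using Q by (simp add: equivalent_SES_set_def)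
      then show ?thesis by (rule reversible_interaccessible)
    qed
  qed
  have eq: "temp a = temp b" if "a \<in> P" "b \<in> P" "E a = E b" for a b
  proof (rule temp_eqI)
    show "SES W a" "SES W b" using that P by simp_all
    show "interaccessible W a b" by (rule eqv[OF that])
    show "interaccessible W a' b'"
      if "SES W a'" "SES W b'" "same_regions W a a'" "same_regions W b b'" "E a' = E b'" for a' b'
      using eqv[of a' b'] P_same_regions[of a a'] P_same_regions[of b b'] \<open>a \<in> P\<close> \<open>b \<in> P\<close> that
      by blast
  qed
  have less: "temp a < temp b" if ab: "a \<in> P" "b \<in> P" "E a < E b" for a b
  proof -
    have a: "SES W a" using ab P by simp
    \<comment> \<open>\<open>a\<close> and \<open>b\<close> may occupy different regions:
      \<open>c\<close> has the regions of \<open>a\<close> and the energy of \<open>b\<close>, so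
      that \<open>temp_strict_mono\<close> compares \<open>a\<close> with \<open>c\<close> and
      \<open>eq\<close> compares \<open>c\<close> with \<open>b\<close>.\<close>
    obtain c where c: "SES W c" "same_regions W a c" "E c = E b"
      using SES_raise[OF a less_imp_le[OF ab(3)]] by blast
    then have "temp a < temp c" using temp_strict_mono a ab by simp
    then show ?thesis using eq[of c b] P_same_regions c ab by simp
  qed
  \<comment> \<open>The choice is immaterial by \<open>eq\<close>.\<close>
  define T where "T e = temp (SOME a. a \<in> P \<and> E a = e)" for e
  have T: "T (E a) = temp a" if a: "a \<in> P" for a
  proof -
    have "(SOME b. b \<in> P \<and> E b = E a) \<in> P \<and> E (SOME b. b \<in> P \<and> E b = E a) = E a"
      by (rule someI[of _ a]) (simp add: a)
    then show ?thesis unfolding T_def using eq a by blast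
  qed
  have "strict_mono_on (E ` P) T"
    by (rule strict_mono_onI) (use T less in auto)
  then show ?thesis using T unfolding P_def by force
qed

end
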